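(* Let $G$, $W$, $\mathbb D$, $d$, $n$, $q=dn$, $V=W\oplus W$, $E_{\mathbb D}$, $r_{\mathbb D}=d+1$, $H$ and $Z$ be as in the context. Let $x_1,\dots,x_s\in S(V)$ and $w_1,\dots,w_s>0$ with $\sum_iw_i=1$, put $Z_i=Z(x_i)$, and assume that $$\sum_i w_iZ_i=0,\qquad \sum_i w_i\,Z_i\otimes Z_i=\frac{1}{2(q+1)}I_{E_{\mathbb D}},$$ and that at least one of the orbits $Gx_i$ is itself a spherical $2$-design. Let $\alpha=\sum_{i:\,Z_i\neq0}w_i$. Then $$\alpha\ \ge\ \frac{r_{\mathbb D}}{q+1}=\frac{d+1}{dn+1}.$$ Equivalently, the total weight carried by those orbits $Gx_i$ that are spherical $2$-designs is at most $\frac{d(n-1)}{dn+1}$. Equality holds if and only if $H(x_i)$ has rank one for every $i$ with $Z_i\ne0$.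
   Context: Let $G$ be a finite group and $W$ a nontrivial irreducible (finite-dimensional) real orthogonal $G$-module. Put $\mathbb D=\operatorname{End}_G(W)\in\{\mathbb R,\mathbb C,\mathbb H\}$ and regard $W$ as a right $\mathbb D$-module (in quaternionic type via $\operatorname{End}_G(W)^{\mathrm{op}}\simeq\mathbb H$). Put $d=\dim_{\mathbb R}\mathbb D\in\{1,2,4\}$, $n=\dim_{\mathbb D}W$, $q=\dim_{\mathbb R}W=dn$. Fix a $G$-invariant $\mathbb D$-Hermitian form $\langle\cdot,\cdot\rangle$ on $W$ (with $\langle xa,yb\rangle=\bar a\langle x,y\rangle b$) whose real part is the given real inner product. Let $V=W\oplus W$ with the diagonal $G$-action and the orthogonal direct sum inner product, and $S(V)$ its unit sphere. For $x=(x_1,x_2)\in V$, the Hermitian Gram matrix is $H(x)=(\langle x_i,x_j\rangle)_{i,j}\in\operatorname{Herm}_2(\mathbb D)$. Let $E_{\mathbb D}$ be the real space of traceless matrices in $\operatorname{Herm}_2(\mathbb D)$ with inner product $\langle B,C\rangle_E=\operatorname{Re}\operatorname{tr}(BC)$; its real dimension is $r_{\mathbb D}=d+1$. For $x\in S(V)$ the quadratic defect is $Z(x)=H(x)-\frac12I_2\in E_{\mathbb D}$; it is constant on $G$-orbits. The identity $\sum_i w_iZ_i\otimes Z_i=c\,I_{E_{\mathbb D}}$ means $\sum_i w_i\langle B,Z_i\rangle_E\langle C,Z_i\rangle_E=c\langle B,C\rangle_E$ for all $B,C\in E_{\mathbb D}$. A finite nonempty set $X\subset S(V)$ is a spherical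 $2$-design if $\frac1{|X|}\sum_{x\in X}f(x)$ equals the average of $f$ over $S(V)$ for every real polynomial $f$ of degree at most $2$. *)

theory Defs
  imports "HOL-Analysis.Analysis" "HOL-Algebra.Group_Action"
begin

section \<open>The scalars: real numbers, complex numbers, quaternions\<close>

text \<open>
  A finite-dimensional associative real division algebra whose Euclidean norm is multiplicative.
  By the theorems of Frobenius and Hurwitz, the models are, up to isometric isomorphism, exactly
  the reals, the complex numbers and the quaternions, all three of which are instances
  below. Since the norm of \<open>1\<close> is \<open>1\<close>, the inner product with \<open>1\<close> is the real part, and its
  kernel is the space of purely imaginary elements.
\<close>

class rch = real_normed_div_algebra + euclidean_space

definition re_part :: "'d::rch \<Rightarrow> real"
  where "re_part a = a \<bullet> 1"

definition conjugate :: "'d::rch \<Rightarrow> 'd"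
  where "conjugate a = (2 * re_part a) *\<^sub>R 1 - a"

instance real :: rch ..

instance complex :: rch ..

lemma re_part_real: "re_part (a::real) = a"
  by (simp add: re_part_def)

lemma conjugate_real: "conjugate (a::real) = a"
  by (simp add: conjugate_def re_part_def)

lemma re_part_complex: "re_part (a::complex) = Re a"
  by (simp add: re_part_def)

lemma conjugate_complex: "conjugate (a::complex) = cnj a"
  by (simp add: conjugate_def re_part_def complex_eq_iff)

datatype quat = Quat (q0: real) (q1: real) (q2: real) (q3: real)

lemma quat_eq_iff: "x = y \<longleftrightarrow> q0 x = q0 y \<and> q1 x = q1 y \<and> q2 x = q2 y \<and> q3 x = q3 y"
  by (cases x; cases y) simp

instantiation quat :: real_normed_div_algebra
begin

definition "0 = Quat 0 0 0 0"
definition "1 = Quat 1 0 0 0"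
definition "x + y = Quat (q0 x + q0 y) (q1 x + q1 y) (q2 x + q2 y) (q3 x + q3 y)"
definition "- x = Quat (- q0 x) (- q1 x) (- q2 x) (- q3 x)"
definition "x - y = Quat (q0 x - q0 y) (q1 x - q1 y) (q2 x - q2 y) (q3 x - q3 y)"
definition "x * y = Quat
  (q0 x * q0 y - q1 x * q1 y - q2 x * q2 y - q3 x * q3 y)
  (q0 x * q1 y + q1 x * q0 y + q2 x * q3 y - q3 x * q2 y)
  (q0 x * q2 y - q1 x * q3 y + q2 x * q0 y + q3 x * q1 y)
  (q0 x * q3 y + q1 x * q2 y - q2 x * q1 y + q3 x * q0 y)"
definition "r *\<^sub>R x = Quat (r * q0 x) (r * q1 x) (r * q2 x) (r * q3 x)"
definition "norm x = sqrt ((q0 x)\<^sup>2 + (q1 x)\<^sup>2 + (q2 x)\<^sup>2 + (q3 x)\<^sup>2)" for x :: quat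
definition "inverse x = (1 / (norm x)\<^sup>2) *\<^sub>R Quat (q0 x) (- q1 x) (- q2 x) (- q3 x)"
definition "x div y = x * inverse y" for x y :: quat
definition "sgn x = inverse (norm x) *\<^sub>R x" for x :: quat
definition "dist x y = norm (x - y)" for x y :: quat
definition "uniformity = (INF e\<in>{0<..}. principal {(x::quat, y). dist x y < e})"
definition "open U \<longleftrightarrow> (\<forall>x\<in>U. eventually (\<lambda>(x', y). x' = x \<longrightarrow> y \<in> U) uniformity)" for U :: "quat set"

lemmas quat_ops = zero_quat_def one_quat_def plus_quat_def uminus_quat_def minus_quat_def
  times_quat_def scaleR_quat_def

lemma norm_quat_sq: "(norm x)\<^sup>2 = (q0 x)\<^sup>2 + (q1 x)\<^sup>2 + (q2 x)\<^sup>2 + (q3 x)\<^sup>2" for x :: quat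
  by (simp add: norm_quat_def)

lemma norm_quat_L2: "norm x = L2_set (\<lambda>i. [q0 x, q1 x, q2 x, q3 x] ! i) {..<4}" for x :: quat
  by (simp add: norm_quat_def L2_set_def eval_nat_numeral)

instance
proof
  fix x y z :: quat and a b :: real
  show "x + y + z = x + (y + z)" "x + y = y + x" "0 + x = x" "- x + x = 0" "x - y = x + - y"
    by (simp_all add: quat_ops quat_eq_iff)
  show "a *\<^sub>R (x + y) = a *\<^sub>R x + a *\<^sub>R y" "(a + b) *\<^sub>R x = a *\<^sub>R x + b *\<^sub>R x"
    "a *\<^sub>R b *\<^sub>R x = (a * b) *\<^sub>R x" "1 *\<^sub>R x = x"
    by (simp_all add: quat_ops quat_eq_iff algebra_simps)
  show "x * y * z = x * (y * z)" "(x + y) * z = x * z + y * z" "x * (y + z) = x * y + x * z"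
    "a *\<^sub>R x * y = a *\<^sub>R (x * y)" "x * a *\<^sub>R y = a *\<^sub>R (x * y)" "1 * x = x" "x * 1 = x"
    "(0::quat) \<noteq> 1"
    by (simp_all add: quat_ops quat_eq_iff algebra_simps)
  show norm0: "norm x = 0 \<longleftrightarrow> x = 0"
    by (simp add: norm_quat_def zero_quat_def quat_eq_iff add_nonneg_eq_0_iff)
  show "inverse x * x = 1" "x * inverse x = 1" if "x \<noteq> 0"
  proof -
    define k where "k = 1 / (norm x)\<^sup>2"
    have k: "k * (q0 x * q0 x) + k * (q1 x * q1 x) + k * (q2 x * q2 x) + k * (q3 x * q3 x) = 1"
    proof -
      have "k * (norm x)\<^sup>2 = 1" using that norm0 by (simp add: k_def)
      then show ?thesis unfolding norm_quat_sq by (simp add: power2_eq_square distrib_left)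
    qed
    show "inverse x * x = 1" "x * inverse x = 1"
      unfolding inverse_quat_def k_def [symmetric] quat_ops quat_eq_iff
      using k by (simp_all add: algebra_simps)
  qed
  show "inverse (0::quat) = 0"
    by (simp add: inverse_quat_def quat_ops)
  show "norm (x + y) \<le> norm x + norm y"
  proof -
    have "norm (x + y) = L2_set (\<lambda>i. [q0 x, q1 x, q2 x, q3 x] ! i + [q0 y, q1 y, q2 y, q3 y] ! i) {..<4}"
      by (simp add: norm_quat_def plus_quat_def L2_set_def eval_nat_numeral)
    then show ?thesis
      unfolding norm_quat_L2 [of x] norm_quat_L2 [of y] by (simp add: L2_set_triangle_ineq)
  qed
  show "norm (a *\<^sub>R x) = \<bar>a\<bar> * norm x"
    by (rule power2_eq_imp_eq)
      (simp_all add: norm_quat_sq power_mult_distrib, simp_all add: norm_quat_def quat_ops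
        power_mult_distrib algebra_simps)
  show "norm (x * y) = norm x * norm y"
    unfolding norm_quat_def real_sqrt_mult [symmetric] times_quat_def
    by (rule arg_cong [where f = sqrt]) (simp add: power2_eq_square algebra_simps)
  show "x div y = x * inverse y" by (rule divide_quat_def)
  show "sgn x = inverse (norm x) *\<^sub>R x" by (rule sgn_quat_def)
  show "dist x y = norm (x - y)" by (rule dist_quat_def)
  show "uniformity = (INF e\<in>{0<..}. principal {(x::quat, y). dist x y < e})"
    by (rule uniformity_quat_def)
  show "open U \<longleftrightarrow> (\<forall>x\<in>U. eventually (\<lambda>(x', y). x' = x \<longrightarrow> y \<in> U) uniformity)" for U :: "quat set"
    by (rule open_quat_def)
qed

end

instantiation quat :: euclidean_space
begin

definition "inner x y = q0 x * q0 y + q1 x * q1 y + q2 x * q2 y + q3 x * q3 y"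
definition "Basis = {Quat 1 0 0 0, Quat 0 1 0 0, Quat 0 0 1 0, Quat 0 0 0 1}"

instance
proof
  fix x y z :: quat and r :: real
  show "x \<bullet> y = y \<bullet> x" "(x + y) \<bullet> z = x \<bullet> z + y \<bullet> z" "(r *\<^sub>R x) \<bullet> y = r * (x \<bullet> y)"
    by (simp_all add: inner_quat_def quat_ops algebra_simps)
  show "0 \<le> x \<bullet> x"
    by (simp add: inner_quat_def)
  show nrm: "norm x = sqrt (x \<bullet> x)"
    by (simp add: norm_quat_def inner_quat_def power2_eq_square)
  show "x \<bullet> x = 0 \<longleftrightarrow> x = 0"
    using norm_eq_zero [of x] unfolding nrm by simp
  show "(Basis :: quat set) \<noteq> {}" "finite (Basis :: quat set)"
    by (simp_all add: Basis_quat_def)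
  show "x \<bullet> y = (if x = y then 1 else 0)" if "x \<in> Basis" "y \<in> Basis"
    using that unfolding Basis_quat_def inner_quat_def by fastforce
  show "(\<forall>u\<in>Basis. x \<bullet> u = 0) \<longleftrightarrow> x = 0"
    by (cases x) (simp add: Basis_quat_def inner_quat_def zero_quat_def)
qed

end

instance quat :: rch ..

lemma re_part_quat: "re_part a = q0 a"
  by (simp add: re_part_def inner_quat_def one_quat_def)

lemma conjugate_quat: "conjugate a = Quat (q0 a) (- q1 a) (- q2 a) (- q3 a)"
  by (simp add: conjugate_def re_part_quat quat_ops)


section \<open>Right vector spaces over the scalars\<close>

text \<open>
  The library's vector spaces require a commutative field of scalars. Here \<open>act v a\<close> is the
  product of the vector \<open>v\<close> with the scalar \<open>a\<close> on the right.
\<close>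

definition right_span :: "('v::comm_monoid_add \<Rightarrow> 'd::rch \<Rightarrow> 'v) \<Rightarrow> 'v set \<Rightarrow> 'v set"
  where "right_span act B = {\<Sum>v\<in>F. act v (c v) | F c. finite F \<and> F \<subseteq> B}"

definition right_independent :: "('v::comm_monoid_add \<Rightarrow> 'd::rch \<Rightarrow> 'v) \<Rightarrow> 'v set \<Rightarrow> bool"
  where "right_independent act B \<longleftrightarrow>
    (\<forall>F c. finite F \<and> F \<subseteq> B \<and> (\<Sum>v\<in>F. act v (c v)) = 0 \<longrightarrow> (\<forall>v\<in>F. c v = 0))"

definition right_dim :: "('v::comm_monoid_add \<Rightarrow> 'd::rch \<Rightarrow> 'v) \<Rightarrow> 'v set \<Rightarrow> nat"
  where "right_dim act S =
    card (SOME B. B \<subseteq> S \<and> right_independent act B \<and> S \<subseteq> right_span act B)"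

text \<open>The dimension of the column space, a right subspace of the space of column vectors.\<close>

definition matrix_rank :: "'d::rch^'n^'m \<Rightarrow> nat"
  where "matrix_rank A = right_dim (\<lambda>v a. \<chi> i. v $ i * a) (range ((*v) A))"


section \<open>Irreducible modules and their invariant Hermitian forms\<close>

text \<open>
  The module \<open>W\<close> is the type \<open>'w\<close>; it is nonzero because every Euclidean space is.
\<close>

locale irreducible_orthogonal_module = group_action G UNIV \<phi>
  for G :: "('g, 'm) monoid_scheme" (structure) and \<phi> :: "'g \<Rightarrow> 'w::euclidean_space \<Rightarrow> 'w" +
  assumes finite_group: "finite (carrier G)"
    and orthogonal: "g \<in> carrier G \<Longrightarrow> orthogonal_transformation (\<phi> g)"
    and irreducible: "\<lbrakk>subspace S; \<And>g. g \<in> carrier G \<Longrightarrow> \<phi> g ` S \<subseteq> S\<rbrakk> \<Longrightarrow> S = {0} \<or> S = UNIV"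
    and nontrivial: "\<exists>g\<in>carrier G. \<phi> g \<noteq> id"

definition endomorphisms ::
    "('g, 'm) monoid_scheme \<Rightarrow> ('g \<Rightarrow> 'w::real_vector \<Rightarrow> 'w) \<Rightarrow> ('w \<Rightarrow> 'w) set"
  where "endomorphisms G \<phi> = {T. linear T \<and> (\<forall>g\<in>carrier G. T \<circ> \<phi> g = \<phi> g \<circ> T)}"

text \<open>
  The type \<open>'d\<close> is identified with \<open>End\<^sub>G(W)\<close> by sending \<open>a\<close> to the right multiplication
  \<open>x \<mapsto> x \<cdot> a\<close>. Because \<open>(x \<cdot> a) \<cdot> b = x \<cdot> (a * b)\<close>, this is an algebra isomorphism from \<open>'d\<close>
  onto the opposite algebra of \<open>End\<^sub>G(W)\<close>; the distinction only matters for quaternions.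
\<close>

locale hermitian_module = irreducible_orthogonal_module G \<phi>
  for G :: "('g, 'm) monoid_scheme" (structure) and \<phi> :: "'g \<Rightarrow> 'w::euclidean_space \<Rightarrow> 'w" +
  fixes act :: "'w \<Rightarrow> 'd::rch \<Rightarrow> 'w"  (infixl \<open>\<cdot>\<close> 75)
    and form :: "'w \<Rightarrow> 'w \<Rightarrow> 'd"
  assumes act_bij: "bij_betw (\<lambda>a x. x \<cdot> a) UNIV (endomorphisms G \<phi>)"
    and act_add: "x \<cdot> (a + b) = x \<cdot> a + x \<cdot> b"
    and act_scaleR: "x \<cdot> (r *\<^sub>R a) = r *\<^sub>R (x \<cdot> a)"
    and act_one: "x \<cdot> 1 = x"
    and act_mult: "x \<cdot> (a * b) = x \<cdot> a \<cdot> b"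
    and form_add_left: "form (x + y) z = form x z + form y z"
    and form_add_right: "form x (y + z) = form x y + form x z"
    and form_sesquilinear: "form (x \<cdot> a) (y \<cdot> b) = conjugate a * form x y * b"
    and form_hermitian: "form y x = conjugate (form x y)"
    and form_invariant: "g \<in> carrier G \<Longrightarrow> form (\<phi> g x) (\<phi> g y) = form x y"
    and form_real_part: "re_part (form x y) = x \<bullet> y"

text \<open>
  The module \<open>V = W \<oplus> W\<close> is \<open>'w^2\<close>, whose library inner product is the orthogonal direct sum.
\<close>

definition diagonal_action :: "('g \<Rightarrow> 'w \<Rightarrow> 'w) \<Rightarrow> 'g \<Rightarrow> 'w^2 \<Rightarrow> 'w^2"
  where "diagonal_action \<phi> g x = (\<chi> i. \<phi> g (x $ i))"

definition hermitian_gram :: "('w \<Rightarrow> 'w \<Rightarrow> 'd) \<Rightarrow> 'w^2 \<Rightarrow> 'd^2^2"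
  where "hermitian_gram form x = (\<chi> i j. form (x $ i) (x $ j))"

definition quadratic_defect :: "('w \<Rightarrow> 'w \<Rightarrow> 'd::rch) \<Rightarrow> 'w^2 \<Rightarrow> 'd^2^2"
  where "quadratic_defect form x = hermitian_gram form x - (1/2) *\<^sub>R mat 1"

definition traceless_hermitian :: "('d::rch^2^2) set"
  where "traceless_hermitian = {B. (\<forall>i j. B $ j $ i = conjugate (B $ i $ j)) \<and> trace B = 0}"

definition trace_inner :: "'d::rch^2^2 \<Rightarrow> 'd^2^2 \<Rightarrow> real"
  where "trace_inner B C = re_part (trace (B ** C))"


section \<open>Spherical designs\<close>

definition polynomial_of_degree_le :: "nat \<Rightarrow> ('v::euclidean_space \<Rightarrow> real) \<Rightarrow> bool"
  where "polynomial_of_degree_le t f \<longleftrightarrow>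
    (\<exists>M c. finite M \<and> (\<forall>m\<in>M. (\<Sum>b\<in>Basis. m b) \<le> t) \<and>
      f = (\<lambda>x. \<Sum>m\<in>M. c m * (\<Prod>b\<in>Basis. (x \<bullet> b) ^ m b)))"

text \<open>
  The normalized surface measure of the unit sphere is the image of the normalized Lebesgue
  measure of the unit ball under radial projection.
\<close>

definition sphere_average :: "('v::euclidean_space \<Rightarrow> real) \<Rightarrow> real"
  where "sphere_average f =
    (LINT x:ball 0 1|lborel. f (x /\<^sub>R norm x)) / measure lborel (ball 0 1 :: 'v set)"

definition spherical_design :: "nat \<Rightarrow> 'v::euclidean_space set \<Rightarrow> bool"
  where "spherical_design t X \<longleftrightarrow> finite X \<and> X \<noteq> {} \<and> X \<subseteq> sphere 0 1 \<and>
    (\<forall>f. polynomial_of_degree_le t f \<longrightarrow> (\<Sum>x\<in>X. f x) / card X = sphere_average f)"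

end

theory Submission
  imports Defs
begin

text \<open>
  For an orbit, the operator \<open>u \<mapsto> \<Sum>y. (u \<bullet> y\<^sub>i) y\<^sub>j\<close>, summed over the points \<open>y\<close> of the orbit of \<open>x\<close>,
  is \<open>G\<close>-equivariant, hence a right multiplication by a scalar, and taking traces shows that
  this scalar is a positive multiple of \<open>\<langle>x\<^sub>i, x\<^sub>j\<rangle>\<close>. Since the first moment of the orbit vanishes, the orbit is a
  2-design if and only if \<open>H(x) = I/2\<close>, that is \<open>Z(x) = 0\<close>; so the two weights in question add up to 1.
  Contracting the tight frame identity over an orthonormal basis of \<open>E\<close> gives
  \<open>\<Sum>i. w\<^sub>i |Z\<^sub>i|\<^sup>2 = r / (2 (q + 1))\<close>. As \<open>tr H(x) = 1\<close>, one has \<open>|Z(x)|\<^sup>2 = 1/2 - 2 det H(x) \<le> 1/2\<close> by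
  Cauchy--Schwarz, with equality exactly when \<open>H(x)\<close> has rank one. Ranks and dimensions over the
  scalars are computed from real dimensions.
\<close>

section \<open>Algebra of the scalars\<close>

lemma re_part_add: "re_part (a + b) = re_part a + re_part b"
  by (simp add: re_part_def inner_add_left)

lemma re_part_scaleR: "re_part (r *\<^sub>R a) = r * re_part a"
  by (simp add: re_part_def)

lemma inner_one_one: "(1::'d::rch) \<bullet> 1 = 1"
  by (simp add: dot_square_norm)

lemma re_part_one: "re_part (1::'d::rch) = 1"
  by (simp add: re_part_def inner_one_one)

lemma conjugate_add: "conjugate (a + b) = conjugate a + conjugate b"
  by (simp add: conjugate_def re_part_def algebra_simps inner_add_left)

lemma conjugate_scaleR: "conjugate (r *\<^sub>R a) = r *\<^sub>R conjugate a"
  by (simp add: conjugate_def re_part_def algebra_simps)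

lemma conjugate_conjugate: "conjugate (conjugate a) = a"
  by (simp add: conjugate_def re_part_def algebra_simps inner_diff_left inner_one_one)

lemma conjugate_one: "conjugate (1::'d::rch) = 1"
  by (simp add: conjugate_def re_part_one scaleR_2)

lemma add_conjugate: "a + conjugate a = (2 * re_part a) *\<^sub>R 1"
  by (simp add: conjugate_def)

lemma conjugate_eq_self_iff: "conjugate a = a \<longleftrightarrow> a = re_part a *\<^sub>R 1"
proof
  assume "conjugate a = a"
  then have "a + a = (2 * re_part a) *\<^sub>R 1" using add_conjugate [of a] by simp
  then have "2 *\<^sub>R a = 2 *\<^sub>R (re_part a *\<^sub>R 1)" by (simp add: scaleR_2)
  then show "a = re_part a *\<^sub>R 1" by (subst (asm) scaleR_cancel_left) simp
next
  assume "a = re_part a *\<^sub>R 1"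
  then show "conjugate a = a" by (metis conjugate_one conjugate_scaleR)
qed

lemma inner_conjugate_conjugate: "conjugate a \<bullet> conjugate b = a \<bullet> b"
  by (simp add: conjugate_def re_part_def inner_diff_left inner_diff_right inner_one_one
      inner_commute algebra_simps)

text \<open>
  The norm of \<open>a\<^sup>2 - |a|\<^sup>2 = (a - |a|) (a + |a|)\<close> is known by multiplicativity, which forces
  \<open>a\<^sup>2\<close> to have the inner product \<open>-|a|\<^sup>2\<close> with \<open>1\<close>, the extreme value allowed by Cauchy--Schwarz.
\<close>

lemma square_imaginary:
  fixes a :: "'d::rch"
  assumes "re_part a = 0"
  shows "a * a = - ((norm a)\<^sup>2 *\<^sub>R 1)"
proof -
  define k where "k = norm a"
  have a1: "a \<bullet> 1 = 0" "1 \<bullet> a = 0" using assms by (simp_all add: re_part_def inner_commute)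
  have aa: "a \<bullet> a = k\<^sup>2" by (simp add: k_def dot_square_norm)
  have sq: "(a * a) \<bullet> (a * a) = k ^ 4"
    by (simp add: dot_square_norm norm_mult k_def power4_eq_xxxx power2_eq_square)
  have fac: "a * a - k\<^sup>2 *\<^sub>R 1 = (a - k *\<^sub>R 1) * (a + k *\<^sub>R 1)"
    by (simp add: algebra_simps power2_eq_square)
  have n1: "(norm (a - k *\<^sub>R 1))\<^sup>2 = 2 * k\<^sup>2" "(norm (a + k *\<^sub>R 1))\<^sup>2 = 2 * k\<^sup>2"
    by (simp_all add: a1 aa inner_one_one algebra_simps inner_diff_left inner_diff_right
        inner_add_left inner_add_right power2_norm_eq_inner, simp_all add: power2_eq_square)
  have "(norm (a * a - k\<^sup>2 *\<^sub>R 1))\<^sup>2 = 4 * k ^ 4"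
    unfolding fac norm_mult power_mult_distrib n1 by (simp add: power4_eq_xxxx power2_eq_square)
  moreover have "(norm (a * a - k\<^sup>2 *\<^sub>R 1))\<^sup>2 = k ^ 4 - 2 * k\<^sup>2 * ((a * a) \<bullet> 1) + k ^ 4"
    unfolding power2_norm_eq_inner
    by (simp add: inner_diff_left inner_diff_right inner_one_one sq inner_commute [of 1 "a * a"]
        power4_eq_xxxx power2_eq_square right_diff_distrib)
  ultimately have "k\<^sup>2 * ((a * a) \<bullet> 1) = k\<^sup>2 * (- k\<^sup>2)"
    by (simp add: power4_eq_xxxx power2_eq_square right_diff_distrib)
  then have s: "(a * a) \<bullet> 1 = - k\<^sup>2 \<or> k = 0" by (subst (asm) mult_cancel_left) auto
  show ?thesis
  proof (cases "k = 0")
    case True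
    then show ?thesis by (simp add: k_def)
  next
    case False
    with s have "(a * a) \<bullet> 1 = - k\<^sup>2" by simp
    then have "(a * a + k\<^sup>2 *\<^sub>R 1) \<bullet> (a * a + k\<^sup>2 *\<^sub>R 1) = 0"
      by (simp add: inner_add_left inner_add_right inner_one_one sq inner_commute [of 1 "a * a"]
          power4_eq_xxxx power2_eq_square)
    then have "a * a + k\<^sup>2 *\<^sub>R 1 = 0" by (simp only: inner_eq_zero_iff)
    then show ?thesis by (simp add: k_def add_eq_0_iff2)
  qed
qed

text \<open>Split \<open>a\<close> into a real multiple \<open>t\<close> of 1 and an imaginary part
  \<open>v\<close>. As \<open>t\<close> is central, both products equal t^2 - v^2, and
  \<open>square_imaginary\<close> turns this into the squared norm.\<close>

lemma
  fixes a :: "'d::rch"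
  shows conjugate_mult_self: "conjugate a * a = (norm a)\<^sup>2 *\<^sub>R 1"
    and mult_self_conjugate: "a * conjugate a = (norm a)\<^sup>2 *\<^sub>R 1"
proof -
  define t v where "t = re_part a" and "v = a - t *\<^sub>R 1"
  have v0: "re_part v = 0"
    by (simp add: v_def t_def re_part_def inner_diff_left inner_one_one)
  have a: "a = t *\<^sub>R 1 + v" and c: "conjugate a = t *\<^sub>R 1 - v"
    by (simp_all add: v_def conjugate_def t_def algebra_simps flip: scaleR_add_left)
  have "(norm a)\<^sup>2 = t\<^sup>2 + (norm v)\<^sup>2"
    using v0 unfolding a power2_norm_eq_inner
    by (simp add: re_part_def inner_add_left inner_add_right inner_one_one inner_commute
        power2_eq_square)
  then show "conjugate a * a = (norm a)\<^sup>2 *\<^sub>R 1" "a * conjugate a = (norm a)\<^sup>2 *\<^sub>R 1"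
    using square_imaginary [OF v0] unfolding c by (simp_all add: a algebra_simps power2_eq_square)
qed

text \<open>Cancel \<open>a\<close> on the right in \<open>conjugate_mult_self\<close>; at 0 both
  sides vanish because \<open>inverse 0 = 0\<close>. Conjugation then inherits the reversal of
  products from inversion, which gives \<open>conjugate_mult\<close>.\<close>

lemma conjugate_eq_inverse: "conjugate a = (norm a)\<^sup>2 *\<^sub>R inverse a" for a :: "'d::rch"
proof (cases "a = 0")
  case True
  then show ?thesis by (simp add: conjugate_def re_part_def)
next
  case False
  then have "conjugate a = conjugate a * a * inverse a" by (simp add: mult.assoc)
  then show ?thesis by (simp add: conjugate_mult_self)
qed

lemma conjugate_mult: "conjugate (a * b) = conjugate b * conjugate a" for a b :: "'d::rch"
proof (cases "a = 0 \<or> b = 0")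
  case True
  then show ?thesis by (auto simp: conjugate_eq_inverse)
next
  case False
  then show ?thesis
    by (simp add: conjugate_eq_inverse nonzero_inverse_mult_distrib norm_mult power_mult_distrib)
qed

text \<open>Polarization of \<open>conjugate_mult_self\<close>: expanding it at \<open>a + b\<close>
  leaves the cross term plus its conjugate, which is twice the real part of the cross term.\<close>

lemma re_part_conjugate_mult: "re_part (conjugate a * b) = a \<bullet> b" for a b :: "'d::rch"
proof -
  have "conjugate (a + b) * (a + b) = (norm (a + b))\<^sup>2 *\<^sub>R 1" by (rule conjugate_mult_self)
  then have "(conjugate a * b + conjugate b * a) + (norm a)\<^sup>2 *\<^sub>R 1 + (norm b)\<^sup>2 *\<^sub>R 1 =
      (norm (a + b))\<^sup>2 *\<^sub>R 1"
    by (simp only: conjugate_add distrib_left distrib_right conjugate_mult_self ac_simps)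
  also have "(norm (a + b))\<^sup>2 = 2 * (a \<bullet> b) + (norm a)\<^sup>2 + (norm b)\<^sup>2"
    by (simp only: power2_norm_eq_inner inner_add_left inner_add_right inner_commute [of b a])
  finally have "conjugate a * b + conjugate b * a = (2 * (a \<bullet> b)) *\<^sub>R 1"
    by (simp only: scaleR_add_left add_right_cancel)
  moreover have "conjugate b * a = conjugate (conjugate a * b)"
    by (simp add: conjugate_mult conjugate_conjugate)
  ultimately have "(2 * re_part (conjugate a * b)) *\<^sub>R (1::'d) = (2 * (a \<bullet> b)) *\<^sub>R 1"
    by (simp add: add_conjugate)
  then show ?thesis by simp
qed

lemma re_part_mult_conjugate: "re_part (a * conjugate b) = a \<bullet> b" for a b :: "'d::rch"
  using re_part_conjugate_mult [of "conjugate a" "conjugate b"]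
  by (simp add: conjugate_conjugate inner_conjugate_conjugate)

section \<open>Dimensions of right vector spaces\<close>

text \<open>Two instances matter: the module \<open>'w\<close>, and the columns \<open>'d^'m\<close>
  whose right dimension defines \<open>matrix_rank\<close>. The ambient Euclidean structure makes
  comparison with real dimensions possible.\<close>

locale right_vector_space =
  fixes act :: "'v::euclidean_space \<Rightarrow> 'd::rch \<Rightarrow> 'v"  (infixl \<open>\<cdot>\<close> 75)
  assumes add_act: "(x + y) \<cdot> a = x \<cdot> a + y \<cdot> a"
    and act_add: "x \<cdot> (a + b) = x \<cdot> a + x \<cdot> b"
    and act_scaleR: "x \<cdot> (r *\<^sub>R a) = r *\<^sub>R (x \<cdot> a)"
    and act_one: "x \<cdot> 1 = x"
    and act_mult: "x \<cdot> (a * b) = x \<cdot> a \<cdot> b"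
begin

lemma linear_act: "linear (\<lambda>a. x \<cdot> a)"
  by (rule linearI) (simp_all add: act_add act_scaleR)

lemma act_zero [simp]: "x \<cdot> 0 = 0"
  using linear_0 [OF linear_act] .

lemma act_uminus: "x \<cdot> (- a) = - (x \<cdot> a)"
  using linear_neg [OF linear_act] .

lemma zero_act [simp]: "0 \<cdot> a = 0"
  using add_act [of 0 0 a] by simp

lemma uminus_act: "(- x) \<cdot> a = - (x \<cdot> a)"
  using add_act [of "- x" x a] by (simp add: eq_neg_iff_add_eq_0)

lemma act_diff: "x \<cdot> (a - b) = x \<cdot> a - x \<cdot> b"
  using linear_diff [OF linear_act] .

lemma act_sum: "x \<cdot> (\<Sum>i\<in>I. f i) = (\<Sum>i\<in>I. x \<cdot> f i)"
  using linear_sum [OF linear_act] .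

lemma sum_act: "(\<Sum>i\<in>I. f i) \<cdot> a = (\<Sum>i\<in>I. f i \<cdot> a)"
  by (induction I rule: infinite_finite_induct) (simp_all add: add_act)

lemma act_expand: "x \<cdot> a = (\<Sum>e\<in>Basis. (a \<bullet> e) *\<^sub>R (x \<cdot> e))"
proof -
  have "x \<cdot> a = x \<cdot> (\<Sum>e\<in>Basis. (a \<bullet> e) *\<^sub>R e)" by (simp add: euclidean_representation)
  then show ?thesis by (simp add: act_sum act_scaleR)
qed

lemma right_independent_coeff:
  assumes "right_independent (\<cdot>) B" "finite F" "F \<subseteq> B" "(\<Sum>v\<in>F. v \<cdot> c v) = 0" "v \<in> F"
  shows "c v = 0"
  using assms unfolding right_independent_def by blast

text \<open>A coincidence of two such products is a right linear relation: with coefficient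
  \<open>e - e'\<close> if the vectors agree, with coefficients \<open>e\<close> and
  \<open>- e'\<close> otherwise. The second case is impossible, since basis elements are
  nonzero.\<close>

lemma inj_on_act:
  assumes B: "right_independent (\<cdot>) B"
  shows "inj_on (\<lambda>(v, e). v \<cdot> e) (B \<times> Basis)"
proof (rule inj_onI, clarify)
  fix v v' :: 'v and e e' :: 'd
  assume v: "v \<in> B" "v' \<in> B" and e: "e \<in> Basis" "e' \<in> Basis" and eq: "v \<cdot> e = v' \<cdot> e'"
  show "v = v' \<and> e = e'"
  proof (cases "v = v'")
    case True
    then have "(\<Sum>u\<in>{v}. u \<cdot> (e - e')) = 0" using eq by (simp add: act_diff)
    from right_independent_coeff [OF B _ _ this, of v] show ?thesis using True v by simp
  next
    case False
    define c where "c u = (if u = v then e else - e')" for u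
    have "(\<Sum>u\<in>{v, v'}. u \<cdot> c u) = 0" using False eq by (simp add: c_def act_uminus)
    from right_independent_coeff [OF B _ _ this, of v] v have "e = 0" by (simp add: c_def)
    then show ?thesis using e by simp
  qed
qed

text \<open>In a real relation among the products, the real coefficients belonging to one
  \<open>v\<close> are the coordinates of a single scalar \<open>c v\<close>. Right independence
  makes that scalar vanish, and with it all its coordinates.\<close>

lemma independent_act:
  assumes B: "right_independent (\<cdot>) B" and fin: "finite B"
  shows "independent ((\<lambda>(v, e). v \<cdot> e) ` (B \<times> Basis))" (is "independent (?f ` _)")
proof (rule independent_if_scalars_zero)
  show "finite (?f ` (B \<times> Basis))" using fin by simp
next
  fix u y
  assume 0: "(\<Sum>p\<in>?f ` (B \<times> Basis). u p *\<^sub>R p) = 0" and y: "y \<in> ?f ` (B \<times> Basis)"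
  then obtain v e where ve: "v \<in> B" "e \<in> Basis" "y = v \<cdot> e" by auto
  define c where "c v = (\<Sum>e\<in>Basis. u (v \<cdot> e) *\<^sub>R e)" for v
  have "(\<Sum>p\<in>?f ` (B \<times> Basis). u p *\<^sub>R p) = (\<Sum>(v, e)\<in>B \<times> Basis. u (v \<cdot> e) *\<^sub>R (v \<cdot> e))"
    by (subst sum.reindex [OF inj_on_act [OF B]]) (simp add: case_prod_unfold)
  also have "\<dots> = (\<Sum>v\<in>B. v \<cdot> c v)"
    by (simp add: c_def act_sum act_scaleR sum.cartesian_product)
  finally have "(\<Sum>v\<in>B. v \<cdot> c v) = 0" using 0 by simp
  from right_independent_coeff [OF B fin _ this ve(1)] have "c v = 0" by simp
  then have "c v \<bullet> e = 0" by simp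
  then show "u y = 0"
    using ve by (simp add: c_def inner_sum_left inner_Basis if_distrib cong: if_cong)
qed

lemma card_act_image:
  assumes B: "right_independent (\<cdot>) B"
  shows "card ((\<lambda>(v, e). v \<cdot> e) ` (B \<times> Basis)) = card B * DIM('d)"
  by (simp add: card_image [OF inj_on_act [OF B]] card_cartesian_product)

lemma right_independent_subset:
  "right_independent (\<cdot>) B \<Longrightarrow> A \<subseteq> B \<Longrightarrow> right_independent (\<cdot>) A"
  unfolding right_independent_def by (meson order_trans)

text \<open>Each finite subset yields \<open>DIM('d)\<close> times as many really independent
  vectors, so its size is at most \<open>DIM('v)\<close>. An infinite set would contain larger
  finite subsets.\<close>

lemma
  assumes B: "right_independent (\<cdot>) B"
  shows finite_right_independent: "finite B"
    and card_right_independent: "card B \<le> DIM('v)"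
proof -
  have le: "card F \<le> DIM('v)" if F: "finite F" "F \<subseteq> B" for F
  proof -
    have F': "right_independent (\<cdot>) F" using B F(2) by (rule right_independent_subset)
    have "card F * DIM('d) \<le> DIM('v)"
      using independent_bound [OF independent_act [OF F' F(1)]] by (simp add: card_act_image [OF F'])
    moreover have "card F * 1 \<le> card F * DIM('d)"
      using DIM_positive [where 'a='d] by (intro mult_le_mono) linarith+
    ultimately show ?thesis by linarith
  qed
  show "finite B"
  proof (rule ccontr)
    assume "infinite B"
    then obtain F where "finite F" "card F = Suc (DIM('v))" "F \<subseteq> B"
      using infinite_arbitrarily_large by blast
    with le [of F] show False by simp
  qed
  then show "card B \<le> DIM('v)" using le by blast
qed

lemma right_spanI:
  assumes "finite F" "F \<subseteq> B" shows "(\<Sum>v\<in>F. v \<cdot> c v) \<in> right_span (\<cdot>) B"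
  using assms unfolding right_span_def by blast

text \<open>Cardinalities of right independent sets are bounded, so \<open>S\<close> contains one of
  greatest cardinality. An element \<open>s\<close> of \<open>S\<close> outside its span could be
  adjoined: a relation with \<open>c s\<close> nonzero is solved for \<open>s\<close> by acting with
  \<open>inverse (c s)\<close>.\<close>

lemma ex_right_basis:
  "\<exists>B\<subseteq>S. right_independent (\<cdot>) B \<and> S \<subseteq> right_span (\<cdot>) B"
proof -
  define P where "P B \<longleftrightarrow> B \<subseteq> S \<and> right_independent (\<cdot>) B" for B
  have "P {}" by (simp add: P_def right_independent_def)
  moreover have "\<forall>B. P B \<longrightarrow> card B < Suc (DIM('v))"
    using card_right_independent by (auto simp: P_def less_Suc_eq_le)
  ultimately obtain B where B: "P B" and max: "\<And>A. P A \<Longrightarrow> card A \<le> card B"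
    using ex_has_greatest_nat [of P "{}" card] by blast
  have ind: "right_independent (\<cdot>) B" and sub: "B \<subseteq> S" using B by (simp_all add: P_def)
  have "S \<subseteq> right_span (\<cdot>) B"
  proof (rule subsetI, rule ccontr)
    fix s assume s: "s \<in> S" "s \<notin> right_span (\<cdot>) B"
    have "s \<notin> B"
      using s(2) right_spanI [of "{s}" B "\<lambda>_. 1"] by (auto simp: act_one)
    have "right_independent (\<cdot>) (insert s B)"
      unfolding right_independent_def
    proof (intro allI impI)
      fix F c assume "finite F \<and> F \<subseteq> insert s B \<and> (\<Sum>v\<in>F. v \<cdot> c v) = 0"
      then have F: "finite F" "F - {s} \<subseteq> B" and 0: "(\<Sum>v\<in>F. v \<cdot> c v) = 0" by auto
      have "c s = 0" if "s \<in> F"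
      proof (rule ccontr)
        assume cs: "c s \<noteq> 0"
        have "s \<cdot> c s = - (\<Sum>v\<in>F - {s}. v \<cdot> c v)"
          using 0 F(1) that by (simp add: sum.remove add_eq_0_iff2)
        then have "s \<cdot> c s \<cdot> inverse (c s) = (\<Sum>v\<in>F - {s}. v \<cdot> (- c v * inverse (c s)))"
          by (simp add: act_mult act_uminus uminus_act sum_act flip: sum_negf)
        then have "s = (\<Sum>v\<in>F - {s}. v \<cdot> (- c v * inverse (c s)))"
          using cs by (simp add: act_one flip: act_mult)
        also have "\<dots> \<in> right_span (\<cdot>) B" using F by (intro right_spanI) auto
        finally show False using s(2) by simp
      qed
      moreover from this have "(\<Sum>v\<in>F - {s}. v \<cdot> c v) = 0"
        using 0 F(1) by (cases "s \<in> F") (simp_all add: sum.remove)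
      then have "c v = 0" if "v \<in> F - {s}" for v
        using right_independent_coeff [OF ind _ F(2)] F(1) that by blast
      ultimately show "\<forall>v\<in>F. c v = 0" by blast
    qed
    with s(1) sub have "P (insert s B)" by (simp add: P_def)
    from max [OF this] show False
      using \<open>s \<notin> B\<close> finite_right_independent [OF ind] by simp
  qed
  with ind sub show ?thesis by blast
qed

text \<open>The products of a right basis with the real basis of the scalars form a real basis of
  \<open>S\<close>. Hence the number of elements does not depend on which right basis
  \<open>right_dim\<close> picks.\<close>

lemma right_dim_mult_DIM:
  assumes S: "subspace S" "\<And>x a. x \<in> S \<Longrightarrow> x \<cdot> a \<in> S"
  shows "right_dim (\<cdot>) S * DIM('d) = dim S"
proof -
  define B where "B = (SOME B. B \<subseteq> S \<and> right_independent (\<cdot>) B \<and> S \<subseteq> right_span (\<cdot>) B)"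
  have "B \<subseteq> S \<and> right_independent (\<cdot>) B \<and> S \<subseteq> right_span (\<cdot>) B"
    unfolding B_def by (rule someI_ex) (use ex_right_basis in blast)
  then have B: "B \<subseteq> S" "right_independent (\<cdot>) B" "S \<subseteq> right_span (\<cdot>) B" by blast+
  let ?P = "(\<lambda>(v, e). v \<cdot> e) ` (B \<times> Basis)"
  have "right_span (\<cdot>) B \<subseteq> span ?P"
  proof
    fix y assume "y \<in> right_span (\<cdot>) B"
    then obtain F c where F: "F \<subseteq> B" and y: "y = (\<Sum>v\<in>F. v \<cdot> c v)"
      by (auto simp: right_span_def)
    show "y \<in> span ?P"
      unfolding y
      by (subst act_expand) (use F in \<open>force intro!: span_sum span_scale intro: span_base\<close>)
  qed
  moreover have "?P \<subseteq> S" using B(1) S(2) by auto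
  ultimately have "dim S = card ?P"
    using B(3) independent_act [OF B(2) finite_right_independent [OF B(2)]]
    by (intro dim_unique) auto
  moreover have "right_dim (\<cdot>) S = card B" by (simp add: right_dim_def B_def)
  ultimately show ?thesis using card_act_image [OF B(2)] by simp
qed

end

section \<open>Spherical designs of strength two\<close>

definition reflect :: "'v::euclidean_space \<Rightarrow> 'v \<Rightarrow> 'v"
  where "reflect b x = x - (2 * (x \<bullet> b)) *\<^sub>R b"

definition swap_coords :: "'v::euclidean_space \<Rightarrow> 'v \<Rightarrow> 'v \<Rightarrow> 'v"
  where "swap_coords b c x = (\<Sum>j\<in>Basis. (x \<bullet> Transposition.transpose b c j) *\<^sub>R j)"

text \<open>The map is diagonal with entries 1 and -1, so the density in the affine change of
  variables is 1.\<close>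

lemma distr_lborel_reflect:
  assumes b: "b \<in> Basis"
  shows "distr lborel borel (reflect b) = lborel"
proof -
  define c where "c j = (if j = b then - 1 else 1 :: real)" for j
  have "reflect b = (\<lambda>x. 0 + (\<Sum>j\<in>Basis. (c j * (x \<bullet> j)) *\<^sub>R j))"
  proof
    fix x :: 'a
    show "reflect b x = 0 + (\<Sum>j\<in>Basis. (c j * (x \<bullet> j)) *\<^sub>R j)"
      by (rule euclidean_eqI)
        (auto simp: reflect_def c_def inner_sum_left inner_Basis b inner_diff_left if_distrib
          cong: if_cong)
  qed
  then have "lborel = density (distr lborel borel (reflect b)) (\<lambda>_. (\<Prod>j\<in>Basis. \<bar>c j\<bar>))"
    using lborel_affine_euclidean [of c 0] by (simp add: c_def)
  moreover have "(\<Prod>j\<in>Basis. \<bar>c (j::'a)\<bar>) = 1" by (intro prod.neutral) (simp add: c_def)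
  ultimately show ?thesis by (simp add: density_1)
qed

lemma transpose_Basis_iff:
  "b \<in> Basis \<Longrightarrow> c \<in> Basis \<Longrightarrow> Transposition.transpose b c j \<in> Basis \<longleftrightarrow> j \<in> Basis"
  by (auto simp: Transposition.transpose_def)

lemma bij_betw_transpose_Basis:
  assumes "b \<in> Basis" "c \<in> Basis"
  shows "bij_betw (Transposition.transpose b c) Basis Basis"
  by (rule bij_betwI [of _ _ _ "Transposition.transpose b c"])
    (auto simp: transpose_Basis_iff assms)

lemma linear_swap_coords: "linear (swap_coords b c)"
  unfolding swap_coords_def
  by (intro linear_compose_sum ballI linearI) (simp_all add: inner_add_left scaleR_add_left)

lemma inner_swap_coords: "j \<in> Basis \<Longrightarrow> swap_coords b c x \<bullet> j = x \<bullet> Transposition.transpose b c j"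
  by (simp add: swap_coords_def inner_sum_left inner_Basis if_distrib cong: if_cong)

lemma borel_measurable_linear:
  fixes T :: "'a::euclidean_space \<Rightarrow> 'b::real_normed_vector"
  assumes "linear T" shows "T \<in> borel_measurable borel"
  by (intro borel_measurable_continuous_onI linear_continuous_on
      linear_conv_bounded_linear [THEN iffD1] assms)

text \<open>Lebesgue measure is determined by its values on boxes. The preimage of a box is the box
  with two sides exchanged, and the product of the side lengths is unchanged.\<close>

lemma distr_lborel_swap_coords:
  assumes b: "b \<in> Basis" and c: "c \<in> Basis"
  shows "distr lborel borel (swap_coords b c) = lborel"
proof (rule lborel_eqI [symmetric])
  have meas: "swap_coords b c \<in> borel_measurable lborel"
    using borel_measurable_linear [OF linear_swap_coords] by simp
  note bij = bij_betw_transpose_Basis [OF b c]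
  fix l u :: 'a
  assume le: "\<And>j. j \<in> Basis \<Longrightarrow> l \<bullet> j \<le> u \<bullet> j"
  have all: "(\<forall>j\<in>Basis. P (Transposition.transpose b c j)) \<longleftrightarrow> (\<forall>j\<in>Basis. P j)" for P
    using bij by (auto simp: transpose_Basis_iff b c) (metis b c transpose_Basis_iff transpose_involutory)
  have "swap_coords b c -` box l u = box (swap_coords b c l) (swap_coords b c u)"
  proof -
    have "x \<in> swap_coords b c -` box l u \<longleftrightarrow> x \<in> box (swap_coords b c l) (swap_coords b c u)" for x
      using all [of "\<lambda>j. l \<bullet> Transposition.transpose b c j < x \<bullet> j \<and> x \<bullet> j < u \<bullet> Transposition.transpose b c j"]
      by (simp add: mem_box inner_swap_coords)
    then show ?thesis by blast
  qed
  then have "emeasure (distr lborel borel (swap_coords b c)) (box l u) =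
      emeasure lborel (box (swap_coords b c l) (swap_coords b c u))"
    using meas by (simp add: emeasure_distr)
  also have "\<dots> = (\<Prod>j\<in>Basis. (swap_coords b c u - swap_coords b c l) \<bullet> j)"
    by (rule emeasure_lborel_box)
      (simp add: inner_swap_coords le transpose_Basis_iff b c)
  also have "(\<Prod>j\<in>Basis. (swap_coords b c u - swap_coords b c l) \<bullet> j) =
      (\<Prod>j\<in>Basis. (u - l) \<bullet> Transposition.transpose b c j)"
    by (intro prod.cong refl) (simp add: inner_diff_left inner_swap_coords)
  also have "\<dots> = (\<Prod>j\<in>Basis. (u - l) \<bullet> j)"
    by (rule prod.reindex_bij_betw [OF bij])
  finally show "emeasure (distr lborel borel (swap_coords b c)) (box l u) = (\<Prod>j\<in>Basis. (u - l) \<bullet> j)" .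
qed simp

lemma linear_reflect: "linear (reflect b)"
  by (rule linearI) (simp_all add: reflect_def inner_add_left algebra_simps)

lemma inner_reflect: "b \<in> Basis \<Longrightarrow> c \<in> Basis \<Longrightarrow>
    reflect b x \<bullet> c = (if c = b then - (x \<bullet> c) else x \<bullet> c)"
  by (auto simp: reflect_def inner_diff_left inner_Basis)

lemma norm_reflect: "b \<in> Basis \<Longrightarrow> norm (reflect b x) = norm x"
  by (simp add: norm_eq_sqrt_inner reflect_def inner_diff_left inner_diff_right inner_commute)

lemma norm_swap_coords:
  assumes "b \<in> Basis" "c \<in> Basis"
  shows "norm (swap_coords b c x) = norm x"
proof -
  note bij = bij_betw_transpose_Basis [OF assms]
  have "swap_coords b c x \<bullet> swap_coords b c x = (\<Sum>j\<in>Basis. (x \<bullet> Transposition.transpose b c j) * (x \<bullet> Transposition.transpose b c j))"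
    by (subst euclidean_inner) (simp add: inner_swap_coords)
  also have "\<dots> = x \<bullet> x"
    by (subst (3) euclidean_inner) (rule sum.reindex_bij_betw [OF bij])
  finally show ?thesis by (simp add: norm_eq_sqrt_inner)
qed

section \<open>Averages over the sphere\<close>

lemma integrable_radial:
  fixes f :: "'v::euclidean_space \<Rightarrow> real"
  assumes f: "continuous_on UNIV f"
  shows "set_integrable lborel (ball 0 1) (\<lambda>x. f (x /\<^sub>R norm x))"
proof -
  \<comment> \<open>A bound on the sphere alone would miss the origin, which the radial projection
    sends to 0.\<close>
  have "bounded (f ` cball 0 1)"
    by (intro compact_imp_bounded compact_continuous_image continuous_on_subset [OF f]) auto
  then obtain K where K: "\<And>y. y \<in> cball 0 1 \<Longrightarrow> norm (f y) \<le> K"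
    unfolding bounded_iff by blast
  have [measurable]: "f \<in> borel_measurable borel"
    using f by (rule borel_measurable_continuous_onI)
  show ?thesis
    unfolding set_integrable_def
  proof (rule integrableI_bounded_set [where A = "ball 0 1" and B = K])
    show "emeasure lborel (ball (0::'v) 1) < \<infinity>" by (rule emeasure_lborel_ball_finite)
    have "norm (f (x /\<^sub>R norm x)) \<le> K" for x :: 'v
      by (rule K) (cases "x = 0"; simp)
    then show "AE x in lborel. x \<in> ball 0 1 \<longrightarrow> norm (indicat_real (ball 0 1) x *\<^sub>R f (x /\<^sub>R norm x)) \<le> K"
      by (auto simp: indicator_def)
  qed (auto simp: indicator_def)
qed

text \<open>A linear map preserving norms commutes with radial projection and preserves the unit
  ball, so a change of variables along \<open>T\<close> suffices.\<close>

lemma sphere_average_compose: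
  fixes f :: "'v::euclidean_space \<Rightarrow> real" and T :: "'v \<Rightarrow> 'v"
  assumes T: "linear T" "distr lborel borel T = lborel" "\<And>x. norm (T x) = norm x"
    and f: "continuous_on UNIV f"
  shows "sphere_average (\<lambda>x. f (T x)) = sphere_average f"
proof -
  have [measurable]: "f \<in> borel_measurable borel"
    using f by (rule borel_measurable_continuous_onI)
  have [measurable]: "T \<in> borel_measurable borel"
    using T(1) by (rule borel_measurable_linear)
  have "(LINT x:ball 0 1|lborel. f (x /\<^sub>R norm x)) =
      (LINT x:ball 0 1|distr lborel borel T. f (x /\<^sub>R norm x))"
    by (simp add: T(2))
  also have "\<dots> = (LINT x:ball 0 1|lborel. f (T (x /\<^sub>R norm x)))"
    unfolding set_lebesgue_integral_def
    by (subst integral_distr) (auto simp: indicator_def T(3) linear_scale [OF T(1)])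
  finally show ?thesis by (simp add: sphere_average_def)
qed

lemma sphere_average_cmult: "sphere_average (\<lambda>x. c * f x) = c * sphere_average f"
  by (simp add: sphere_average_def)

lemma sphere_average_sum:
  assumes "\<And>i. i \<in> I \<Longrightarrow> continuous_on UNIV (f i)"
  shows "sphere_average (\<lambda>x. \<Sum>i\<in>I. f i x) = (\<Sum>i\<in>I. sphere_average (f i))"
  using integrable_radial [OF assms]
  by (simp add: sphere_average_def set_lebesgue_integral_def set_integrable_def sum_distrib_left
      sum_divide_distrib)

lemma sphere_average_cong:
  fixes f g :: "'v::euclidean_space \<Rightarrow> real"
  assumes "\<And>x. norm x = 1 \<Longrightarrow> f x = g x" and "continuous_on UNIV f" "continuous_on UNIV g"
  shows "sphere_average f = sphere_average g"
proof -
  have [measurable]: "f \<in> borel_measurable borel" "g \<in> borel_measurable borel"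
    using assms by (auto intro: borel_measurable_continuous_onI)
  \<comment> \<open>Only at the origin is the projected point not a unit vector, and a single point
    is a null set.\<close>
  have "AE x in lborel. f (x /\<^sub>R norm x) = g (x /\<^sub>R norm x)"
    using AE_lborel_singleton [of 0] by eventually_elim (simp add: assms(1))
  moreover have "(\<lambda>x. indicator (ball 0 1) x *\<^sub>R f (x /\<^sub>R norm x)) \<in> borel_measurable lborel"
    "(\<lambda>x. indicator (ball 0 1) x *\<^sub>R g (x /\<^sub>R norm x)) \<in> borel_measurable lborel"
    by (auto simp: indicator_def)
  ultimately have "(LINT x:ball 0 1|lborel. f (x /\<^sub>R norm x)) = (LINT x:ball 0 1|lborel. g (x /\<^sub>R norm x))"
    unfolding set_lebesgue_integral_def by (intro integral_cong_AE) auto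
  then show ?thesis by (simp add: sphere_average_def)
qed

lemma sphere_average_one: "sphere_average (\<lambda>x::'v::euclidean_space. 1) = 1"
proof -
  have "measure lborel (ball 0 1 :: 'v set) > 0"
    using content_ball_pos [of 1 "0::'v"] by simp
  then show ?thesis
    using emeasure_lborel_ball_finite [of "0::'v" 1]
    by (simp add: sphere_average_def set_lebesgue_integral_def)
qed

lemma sphere_average_coordinate:
  assumes b: "b \<in> Basis"
  shows "sphere_average (\<lambda>x. x \<bullet> b) = 0"
proof -
  have "sphere_average (\<lambda>x. x \<bullet> b) = sphere_average (\<lambda>x. reflect b x \<bullet> b)"
    by (rule sphere_average_compose [symmetric])
      (auto intro!: continuous_intros simp: linear_reflect distr_lborel_reflect norm_reflect b)
  also have "\<dots> = - sphere_average (\<lambda>x. x \<bullet> b)"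
    using sphere_average_cmult [of "- 1" "\<lambda>x. x \<bullet> b"] by (simp add: inner_reflect b)
  finally show ?thesis by simp
qed

text \<open>For distinct \<open>b\<close> and \<open>c\<close>, reflecting the \<open>b\<close>
  coordinate changes the sign of the integrand. The averages of all squared coordinates agree by
  swapping, and they add up to 1 because the squares sum to 1 on the sphere.\<close>

lemma sphere_average_coordinates:
  fixes b c :: "'v::euclidean_space"
  assumes b: "b \<in> Basis" and c: "c \<in> Basis"
  shows "sphere_average (\<lambda>x. (x \<bullet> b) * (x \<bullet> c)) = (b \<bullet> c) / DIM('v)"
proof (cases "b = c")
  case False
  have "sphere_average (\<lambda>x. (x \<bullet> b) * (x \<bullet> c)) =
      sphere_average (\<lambda>x. (reflect b x \<bullet> b) * (reflect b x \<bullet> c))"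
    by (rule sphere_average_compose [symmetric, where f = "\<lambda>x. (x \<bullet> b) * (x \<bullet> c)"])
      (auto intro!: continuous_intros simp: linear_reflect distr_lborel_reflect norm_reflect b)
  also have "\<dots> = - sphere_average (\<lambda>x. (x \<bullet> b) * (x \<bullet> c))"
    using sphere_average_cmult [of "- 1" "\<lambda>x. (x \<bullet> b) * (x \<bullet> c)"] False
    by (simp add: inner_reflect b c)
  finally show ?thesis using False by (simp add: inner_Basis b c)
next
  case True
  have eq: "sphere_average (\<lambda>x. (x \<bullet> j) * (x \<bullet> j)) = sphere_average (\<lambda>x. (x \<bullet> b) * (x \<bullet> b))"
    if j: "j \<in> Basis" for j :: 'v
  proof -
    have "sphere_average (\<lambda>x. (swap_coords b j x \<bullet> b) * (swap_coords b j x \<bullet> b)) =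
        sphere_average (\<lambda>x. (x \<bullet> b) * (x \<bullet> b))"
      by (rule sphere_average_compose [where f = "\<lambda>x. (x \<bullet> b) * (x \<bullet> b)"])
        (auto intro!: continuous_intros
          simp: linear_swap_coords distr_lborel_swap_coords norm_swap_coords b j)
    then show ?thesis by (simp add: inner_swap_coords b)
  qed
  have "sphere_average (\<lambda>x::'v. \<Sum>j\<in>Basis. (x \<bullet> j) * (x \<bullet> j)) = sphere_average (\<lambda>x::'v. 1)"
    by (rule sphere_average_cong)
      (auto intro!: continuous_intros simp: norm_eq_1 simp flip: euclidean_inner)
  then have "DIM('v) * sphere_average (\<lambda>x. (x \<bullet> b) * (x \<bullet> b)) = 1"
    by (subst (asm) sphere_average_sum)
      (auto intro!: continuous_intros simp: eq sphere_average_one)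
  then show ?thesis using True b by (simp add: field_simps inner_Basis)
qed

section \<open>Monomials of degree at most two\<close>

lemma monomial_Suc:
  fixes m :: "'v::euclidean_space \<Rightarrow> nat"
  assumes "(\<Sum>b\<in>Basis. m b) = Suc k"
  obtains b m' where "b \<in> Basis" "(\<Sum>b\<in>Basis. m' b) = k"
    "\<And>x. (\<Prod>b\<in>Basis. (x \<bullet> b) ^ m b) = (x \<bullet> b) * (\<Prod>b\<in>Basis. (x \<bullet> b) ^ m' b)"
proof -
  obtain b where b: "b \<in> Basis" "m b \<noteq> 0"
    using assms by (metis sum.neutral nat.simps(3))
  define m' where "m' = m(b := m b - 1)"
  have "m' c = m c" if "c \<in> Basis - {b}" for c using that by (simp add: m'_def)
  note this [simp]
  have "(\<Sum>b\<in>Basis. m' b) = k"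
    using assms b by (simp add: sum.remove [OF finite_Basis b(1)] m'_def)
  moreover have "(\<Prod>b\<in>Basis. (x \<bullet> b) ^ m b) = (x \<bullet> b) * (\<Prod>b\<in>Basis. (x \<bullet> b) ^ m' b)" for x
  proof -
    have "(x \<bullet> b) ^ m b = (x \<bullet> b) * (x \<bullet> b) ^ m' b"
      using b(2) by (cases "m b") (simp_all add: m'_def)
    then show ?thesis by (simp add: prod.remove [OF finite_Basis b(1)] mult.assoc)
  qed
  ultimately show thesis using that b(1) by blast
qed

lemma monomial_le_2_cases:
  fixes m :: "'v::euclidean_space \<Rightarrow> nat"
  assumes "(\<Sum>b\<in>Basis. m b) \<le> 2"
  obtains (one) "(\<lambda>x. \<Prod>b\<in>Basis. (x \<bullet> b) ^ m b) = (\<lambda>x. 1)"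
    | (linear) b where "b \<in> Basis" "(\<lambda>x. \<Prod>b\<in>Basis. (x \<bullet> b) ^ m b) = (\<lambda>x. x \<bullet> b)"
    | (quadratic) b c where "b \<in> Basis" "c \<in> Basis"
        "(\<lambda>x. \<Prod>b\<in>Basis. (x \<bullet> b) ^ m b) = (\<lambda>x. (x \<bullet> b) * (x \<bullet> c))"
proof -
  have zero: "(\<Prod>b\<in>Basis. (x \<bullet> b) ^ m b) = 1"
    if "(\<Sum>b\<in>Basis. m b) = 0" for m :: "'v \<Rightarrow> nat" and x
    using that by simp
  consider "(\<Sum>b\<in>Basis. m b) = 0" | "(\<Sum>b\<in>Basis. m b) = Suc 0" | "(\<Sum>b\<in>Basis. m b) = Suc (Suc 0)"
    using assms by linarith
  then show thesis
  proof cases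
    case 1
    then show ?thesis using one zero by simp
  next
    case 2
    then obtain b m' where b: "b \<in> Basis" "(\<Sum>b\<in>Basis. m' b) = 0"
      "\<And>x. (\<Prod>b\<in>Basis. (x \<bullet> b) ^ m b) = (x \<bullet> b) * (\<Prod>b\<in>Basis. (x \<bullet> b) ^ m' b)"
      by (rule monomial_Suc) blast
    show ?thesis by (rule linear [OF b(1)]) (simp only: b(3) zero [OF b(2)] mult_1_right)
  next
    case 3
    then obtain b m' where b: "b \<in> Basis" "(\<Sum>b\<in>Basis. m' b) = Suc 0"
      "\<And>x. (\<Prod>b\<in>Basis. (x \<bullet> b) ^ m b) = (x \<bullet> b) * (\<Prod>b\<in>Basis. (x \<bullet> b) ^ m' b)"
      by (rule monomial_Suc) blast
    obtain c m'' where c: "c \<in> Basis" "(\<Sum>b\<in>Basis. m'' b) = 0"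
      "\<And>x. (\<Prod>b\<in>Basis. (x \<bullet> b) ^ m' b) = (x \<bullet> c) * (\<Prod>b\<in>Basis. (x \<bullet> b) ^ m'' b)"
      using b(2) by (rule monomial_Suc) blast
    show ?thesis
      by (rule quadratic [OF b(1) c(1)]) (simp only: b(3) c(3) zero [OF c(2)] mult_1_right)
  qed
qed

lemma polynomial_of_degree_le_monomial:
  fixes m :: "'v::euclidean_space \<Rightarrow> nat"
  assumes "(\<Sum>b\<in>Basis. m b) \<le> t"
  shows "polynomial_of_degree_le t (\<lambda>x. \<Prod>b\<in>Basis. (x \<bullet> b) ^ m b)"
  unfolding polynomial_of_degree_le_def
  by (rule exI [of _ "{m}"], rule exI [of _ "\<lambda>_. 1"]) (simp add: assms)

lemma polynomial_coordinate:
  assumes b: "b \<in> Basis"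
  shows "polynomial_of_degree_le 2 (\<lambda>x. x \<bullet> b)"
proof -
  define m where "m j = (if j = b then 1 else 0 :: nat)" for j
  have "(\<Prod>j\<in>Basis. (x \<bullet> j) ^ m j) = x \<bullet> b" for x
    by (simp add: m_def if_distrib b cong: if_cong)
  moreover have "(\<Sum>j\<in>Basis. m j) \<le> 2" by (simp add: m_def b)
  ultimately show ?thesis using polynomial_of_degree_le_monomial [of m 2] by simp
qed

lemma polynomial_coordinates:
  assumes b: "b \<in> Basis" and c: "c \<in> Basis"
  shows "polynomial_of_degree_le 2 (\<lambda>x. (x \<bullet> b) * (x \<bullet> c))"
proof -
  define m where "m j = (if j = b then 1 else 0) + (if j = c then 1 else 0 :: nat)" for j
  have "(\<Prod>j\<in>Basis. (x \<bullet> j) ^ m j) =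
      (\<Prod>j\<in>Basis. if j = b then x \<bullet> j else 1) * (\<Prod>j\<in>Basis. if j = c then x \<bullet> j else 1)" for x
    unfolding prod.distrib [symmetric] by (intro prod.cong) (auto simp: m_def)
  then have "(\<Prod>j\<in>Basis. (x \<bullet> j) ^ m j) = (x \<bullet> b) * (x \<bullet> c)" for x
    by (simp add: b c)
  moreover have "(\<Sum>j\<in>Basis. m j) \<le> 2" by (simp add: m_def b c sum.distrib)
  ultimately show ?thesis using polynomial_of_degree_le_monomial [of m 2] by simp
qed

text \<open>By linearity the design condition need only be tested on monomials: constants,
  coordinates, and products of two coordinates. Their sphere averages are 1, 0 and
  \<open>(b \<bullet> c) / DIM('v)\<close>.\<close>

lemma spherical_design_2_iff:
  fixes X :: "'v::euclidean_space set"
  assumes X: "finite X" "X \<noteq> {}" "X \<subseteq> sphere 0 1"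
  shows "spherical_design 2 X \<longleftrightarrow> (\<Sum>x\<in>X. x) = 0 \<and>
    (\<forall>b\<in>Basis. \<forall>c\<in>Basis. (\<Sum>x\<in>X. (x \<bullet> b) * (x \<bullet> c)) = card X * (b \<bullet> c) / DIM('v))"
    (is "_ \<longleftrightarrow> ?R")
proof
  assume des: "spherical_design 2 X"
  have avg: "(\<Sum>x\<in>X. f x) = card X * sphere_average f" if "polynomial_of_degree_le 2 f" for f
    using des that X by (auto simp: spherical_design_def field_simps)
  have "(\<Sum>x\<in>X. x) \<bullet> b = 0" if "b \<in> Basis" for b
    using avg [OF polynomial_coordinate [OF that]] sphere_average_coordinate [OF that]
    by (simp add: inner_sum_left)
  then have "(\<Sum>x\<in>X. x) = 0" using euclidean_all_zero_iff by blast
  then show ?R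
    using avg [OF polynomial_coordinates] by (simp add: sphere_average_coordinates)
next
  assume R: ?R
  show "spherical_design 2 X"
    unfolding spherical_design_def
  proof (intro conjI X allI impI)
    fix f :: "'v \<Rightarrow> real" assume "polynomial_of_degree_le 2 f"
    then obtain M c where M: "finite M" "\<And>m. m \<in> M \<Longrightarrow> (\<Sum>b\<in>Basis. m b) \<le> 2"
      and f: "f = (\<lambda>x. \<Sum>m\<in>M. c m * (\<Prod>b\<in>Basis. (x \<bullet> b) ^ m b))"
      unfolding polynomial_of_degree_le_def by blast
    define p where "p m x = (\<Prod>b\<in>Basis. (x \<bullet> b) ^ m b)" for m and x :: 'v
    have p: "(\<Sum>x\<in>X. p m x) = card X * sphere_average (p m)" if m: "m \<in> M" for m
      using M(2) [OF m]
    proof (cases rule: monomial_le_2_cases)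
      case one
      then have "p m = (\<lambda>x. 1)" by (simp add: p_def fun_eq_iff)
      then show ?thesis by (simp add: sphere_average_one)
    next
      case (linear b)
      then have "p m = (\<lambda>x. x \<bullet> b)" by (simp add: p_def fun_eq_iff)
      then show ?thesis using R linear(1) by (simp add: sphere_average_coordinate flip: inner_sum_left)
    next
      case (quadratic b c)
      then have "p m = (\<lambda>x. (x \<bullet> b) * (x \<bullet> c))" by (simp add: p_def fun_eq_iff)
      then show ?thesis using R quadratic(1,2) by (simp add: sphere_average_coordinates)
    qed
    have "(\<Sum>x\<in>X. f x) = (\<Sum>m\<in>M. c m * (\<Sum>x\<in>X. p m x))"
      by (simp add: f p_def sum_distrib_left sum.swap [of _ X])
    also have "\<dots> = card X * (\<Sum>m\<in>M. c m * sphere_average (p m))"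
      by (simp add: p sum_distrib_left mult.left_commute)
    also have "(\<Sum>m\<in>M. c m * sphere_average (p m)) = sphere_average f"
      unfolding f p_def
      by (subst sphere_average_sum) (auto intro!: continuous_intros simp: sphere_average_cmult)
    finally show "(\<Sum>x\<in>X. f x) / card X = sphere_average f" using X by simp
  qed
qed

section \<open>Second moments of orbits\<close>

context hermitian_module
begin

lemma act_endomorphism: "(\<lambda>x. x \<cdot> a) \<in> endomorphisms G \<phi>"
  using act_bij by (auto simp: bij_betw_def)

lemma endomorphism_is_act: "T \<in> endomorphisms G \<phi> \<Longrightarrow> \<exists>a. T = (\<lambda>x. x \<cdot> a)"
  using act_bij by (auto simp: bij_betw_def)

lemma linear_act_left: "linear (\<lambda>x. x \<cdot> a)"
  using act_endomorphism by (simp add: endomorphisms_def)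

lemma right_vector_space_act: "right_vector_space (\<cdot>)"
  by unfold_locales
    (simp_all add: linear_add [OF linear_act_left] act_add act_scaleR act_one act_mult)

lemma linear_action: "g \<in> carrier G \<Longrightarrow> linear (\<phi> g)"
  using orthogonal by (simp add: orthogonal_transformation_def)

lemma inner_action: "g \<in> carrier G \<Longrightarrow> \<phi> g x \<bullet> \<phi> g y = x \<bullet> y"
  using orthogonal by (simp add: orthogonal_transformation_def)

lemma inner_act: "(x \<cdot> a) \<bullet> y = a \<bullet> form x y"
  using form_real_part [of "x \<cdot> a" y] form_sesquilinear [of x a y 1]
  by (simp add: act_one re_part_conjugate_mult)

lemma form_self: "form x x = (norm x)\<^sup>2 *\<^sub>R 1"
  using form_hermitian [of x x] conjugate_eq_self_iff [of "form x x"]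
  by (simp add: form_real_part power2_norm_eq_inner)

lemma norm_act: "norm (x \<cdot> a) = norm x * norm a"
proof -
  have "(norm (x \<cdot> a))\<^sup>2 = re_part (form (x \<cdot> a) (x \<cdot> a))"
    by (simp add: form_real_part power2_norm_eq_inner)
  also have "\<dots> = (norm x * norm a)\<^sup>2"
    by (subst form_sesquilinear) (simp add: form_self re_part_scaleR conjugate_mult_self re_part_one power_mult_distrib)
  finally show ?thesis by simp
qed

text \<open>Apply the real Cauchy--Schwarz inequality to \<open>act x (form x y)\<close> and
  \<open>y\<close>. Their inner product is the square of \<open>norm (form x y)\<close>, one factor
  of which cancels.\<close>

lemma norm_form_le: "norm (form x y) \<le> norm x * norm y"
proof -
  have "norm (form x y) * norm (form x y) = (x \<cdot> form x y) \<bullet> y"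
    by (simp add: inner_act dot_square_norm power2_eq_square)
  also have "\<dots> \<le> norm (x \<cdot> form x y) * norm y" by (rule norm_cauchy_schwarz)
  finally have "norm (form x y) * norm (form x y) \<le> norm (form x y) * (norm x * norm y)"
    by (simp add: norm_act mult_ac)
  then show ?thesis by (cases "form x y = 0") auto
qed

text \<open>Every basis vector is a unit vector, so \<open>form b b = 1\<close> and each summand is
  the real part of \<open>a\<close>.\<close>

lemma trace_act: "(\<Sum>b\<in>Basis. (b \<cdot> a) \<bullet> b) = DIM('w) * re_part a"
  by (simp add: inner_act form_self re_part_def)

lemma DIM_eq_right_dim: "DIM('w) = right_dim (\<cdot>) (UNIV :: 'w set) * DIM('d)"
proof -
  interpret V: right_vector_space "(\<cdot>)" by (rule right_vector_space_act)
  show ?thesis using V.right_dim_mult_DIM [of UNIV] by simp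
qed

text \<open>The fixed vectors form an invariant subspace, which is proper because the action is
  nontrivial; irreducibility leaves only 0.\<close>

lemma fixed_point_eq_0:
  assumes "\<And>g. g \<in> carrier G \<Longrightarrow> \<phi> g v = v"
  shows "v = 0"
proof -
  let ?S = "{v. \<forall>g\<in>carrier G. \<phi> g v = v}"
  have "subspace ?S"
    by (auto simp: subspace_def linear_0 [OF linear_action] linear_add [OF linear_action]
        linear_scale [OF linear_action])
  then have "?S = {0} \<or> ?S = UNIV" by (rule irreducible) auto
  moreover have "?S \<noteq> UNIV" using nontrivial by (auto simp: fun_eq_iff set_eq_iff)
  ultimately show ?thesis using assms by blast
qed

section \<open>Orbits of the diagonal action and their moments\<close>

lemma diagonal_action_component: "diagonal_action \<phi> g x $ i = \<phi> g (x $ i)"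
  by (simp add: diagonal_action_def)

lemma norm_diagonal_action: "g \<in> carrier G \<Longrightarrow> norm (diagonal_action \<phi> g x) = norm x"
  by (simp add: norm_eq_sqrt_inner inner_vec_def diagonal_action_component inner_action)

lemma finite_orbit: "finite (orbit G (diagonal_action \<phi>) x)"
  using finite_group by (simp add: orbit_def Setcompr_eq_image)

lemma orbit_self: "x \<in> orbit G (diagonal_action \<phi>) x"
proof -
  have "\<phi> \<one> v = v" for v using id_eq_one by (metis UNIV_I restrict_apply)
  then have "diagonal_action \<phi> \<one> x = x" by (simp add: vec_eq_iff diagonal_action_component)
  moreover have "\<one> \<in> carrier G"
    using group_hom group.is_monoid monoid.one_closed by (metis group_hom.axioms(1))
  ultimately show ?thesis unfolding orbit_def by force
qed

lemma orbit_form: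
  "y \<in> orbit G (diagonal_action \<phi>) x \<Longrightarrow> form (y $ i) (y $ j) = form (x $ i) (x $ j)"
  by (auto simp: orbit_def diagonal_action_component form_invariant)

lemma bij_betw_orbit:
  assumes g: "g \<in> carrier G"
  shows "bij_betw (diagonal_action \<phi> g) (orbit G (diagonal_action \<phi>) x)
    (orbit G (diagonal_action \<phi>) x)"
proof -
  have "inj (diagonal_action \<phi> g)"
    using inj_prop [OF g] by (auto simp: inj_on_def vec_eq_iff diagonal_action_component)
  moreover have "diagonal_action \<phi> g ` orbit G (diagonal_action \<phi>) x \<subseteq> orbit G (diagonal_action \<phi>) x"
  proof (clarsimp simp: orbit_def)
    fix h assume h: "h \<in> carrier G"
    have "diagonal_action \<phi> g (diagonal_action \<phi> h x) = diagonal_action \<phi> (g \<otimes> h) x"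
      by (simp add: vec_eq_iff diagonal_action_component composition_rule g h)
    moreover have "g \<otimes> h \<in> carrier G"
      using group_hom g h by (metis group_hom.axioms(1) group.is_monoid monoid.m_closed)
    ultimately show "\<exists>k. diagonal_action \<phi> g (diagonal_action \<phi> h x) = diagonal_action \<phi> k x \<and> k \<in> carrier G"
      by blast
  qed
  ultimately show ?thesis
    by (metis bij_betw_def endo_inj_surj finite_orbit inj_on_subset subset_UNIV)
qed

lemma sum_orbit:
  "g \<in> carrier G \<Longrightarrow> (\<Sum>y\<in>orbit G (diagonal_action \<phi>) x. f (diagonal_action \<phi> g y)) =
    (\<Sum>y\<in>orbit G (diagonal_action \<phi>) x. f y)"
  using sum.reindex_bij_betw [OF bij_betw_orbit] .

text \<open>Each group element permutes the orbit, so both components of the sum are fixed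
  vectors.\<close>

lemma sum_orbit_eq_0: "(\<Sum>y\<in>orbit G (diagonal_action \<phi>) x. y) = 0"
proof -
  let ?X = "orbit G (diagonal_action \<phi>) x"
  have "(\<Sum>y\<in>?X. y $ i) = 0" for i
  proof (rule fixed_point_eq_0)
    fix g assume g: "g \<in> carrier G"
    have "\<phi> g (\<Sum>y\<in>?X. y $ i) = (\<Sum>y\<in>?X. diagonal_action \<phi> g y $ i)"
      by (simp add: linear_sum [OF linear_action [OF g]] diagonal_action_component)
    then show "\<phi> g (\<Sum>y\<in>?X. y $ i) = (\<Sum>y\<in>?X. y $ i)" using sum_orbit [OF g] by simp
  qed
  then show ?thesis by (simp add: vec_eq_iff)
qed

text \<open>
  The left-hand side is equivariant in \<open>u\<close>, hence a right multiplication \<open>u \<mapsto> u \<cdot> a\<close>. The scalar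
  \<open>a\<close> is read off from the traces of \<open>u \<mapsto> u \<cdot> a \<cdot> e\<close>, where \<open>e\<close> ranges over all scalars.
\<close>

lemma orbit_moment:
  "(\<Sum>y\<in>orbit G (diagonal_action \<phi>) x. (u \<bullet> y $ i) *\<^sub>R (y $ j)) =
    (card (orbit G (diagonal_action \<phi>) x) / DIM('w)) *\<^sub>R (u \<cdot> form (x $ i) (x $ j))"
proof -
  let ?X = "orbit G (diagonal_action \<phi>) x"
  define T where "T u = (\<Sum>y\<in>?X. (u \<bullet> y $ i) *\<^sub>R (y $ j))" for u
  have "linear T"
    unfolding T_def
    by (intro linear_compose_sum ballI linearI) (simp_all add: inner_add_left scaleR_add_left)
  moreover have "T (\<phi> g u) = \<phi> g (T u)" if g: "g \<in> carrier G" for g u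
  proof -
    have "T (\<phi> g u) = (\<Sum>y\<in>?X. (\<phi> g u \<bullet> diagonal_action \<phi> g y $ i) *\<^sub>R (diagonal_action \<phi> g y $ j))"
      unfolding T_def using sum_orbit [OF g, of "\<lambda>y. (\<phi> g u \<bullet> y $ i) *\<^sub>R (y $ j)"] by simp
    also have "\<dots> = \<phi> g (T u)"
      by (simp add: T_def diagonal_action_component inner_action g
          linear_sum [OF linear_action] linear_scale [OF linear_action])
    finally show ?thesis .
  qed
  ultimately have "T \<in> endomorphisms G \<phi>" by (simp add: endomorphisms_def fun_eq_iff)
  then obtain a where a: "T = (\<lambda>u. u \<cdot> a)" using endomorphism_is_act by blast
  \<comment> \<open>The indices \<open>i\<close> and \<open>j\<close> come out reversed here, since
    \<open>inner_act\<close> puts the vector acted on, \<open>y $ j\<close>, first in the form.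
    Conjugating the resulting formula for \<open>conjugate a\<close> restores their order.\<close>
  have "DIM('w) * (conjugate a \<bullet> e) = card ?X * (form (x $ j) (x $ i) \<bullet> e)" for e
  proof -
    have "(\<Sum>b\<in>Basis. (T b \<cdot> e) \<bullet> b) = DIM('w) * re_part (a * e)"
      by (simp add: a trace_act flip: act_mult)
    moreover have "re_part (a * e) = conjugate a \<bullet> e"
      by (metis conjugate_conjugate re_part_conjugate_mult)
    moreover have "(\<Sum>b\<in>Basis. (T b \<cdot> e) \<bullet> b) = card ?X * (form (x $ j) (x $ i) \<bullet> e)"
    proof -
      have "(T b \<cdot> e) \<bullet> b = (\<Sum>y\<in>?X. ((y $ j \<cdot> e) \<bullet> b) * (y $ i \<bullet> b))" for b
        by (simp add: T_def linear_sum [OF linear_act_left] linear_scale [OF linear_act_left]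
            inner_sum_left inner_commute [of b] mult.commute)
      then have "(\<Sum>b\<in>Basis. (T b \<cdot> e) \<bullet> b) =
          (\<Sum>b\<in>Basis. \<Sum>y\<in>?X. ((y $ j \<cdot> e) \<bullet> b) * (y $ i \<bullet> b))" by simp
      also have "\<dots> = (\<Sum>y\<in>?X. (y $ j \<cdot> e) \<bullet> (y $ i))"
        by (subst sum.swap) (intro sum.cong refl euclidean_inner [symmetric])
      also have "\<dots> = (\<Sum>y\<in>?X. e \<bullet> form (x $ j) (x $ i))"
        by (intro sum.cong refl) (simp add: inner_act orbit_form)
      finally show ?thesis by (simp add: inner_commute)
    qed
    ultimately show ?thesis by simp
  qed
  then have "(conjugate a - (card ?X / DIM('w)) *\<^sub>R form (x $ j) (x $ i)) \<bullet> e = 0" for e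
    by (simp add: inner_diff_left field_simps)
  then have "conjugate a = (card ?X / DIM('w)) *\<^sub>R form (x $ j) (x $ i)"
    by (metis eq_iff_diff_eq_0 inner_eq_zero_iff)
  then have "a = (card ?X / DIM('w)) *\<^sub>R form (x $ i) (x $ j)"
    by (metis conjugate_conjugate conjugate_scaleR form_hermitian)
  then show ?thesis using fun_cong [OF a, of u] by (simp add: T_def act_scaleR)
qed

lemma quadratic_defect_component:
  "quadratic_defect form x $ i $ j = form (x $ i) (x $ j) - (if i = j then 1 / 2 else 0) *\<^sub>R 1"
  by (simp add: quadratic_defect_def hermitian_gram_def mat_def)

text \<open>The second moment at \<open>axis i u\<close> and \<open>axis j v\<close> and the value
  required of a design are the same positive multiple of \<open>act u c \<bullet> v\<close>, for two
  different scalars \<open>c\<close>. These scalars differ by the entry \<open>i\<close>,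
  \<open>j\<close> of the quadratic defect.\<close>

theorem spherical_design_orbit_iff:
  assumes x: "x \<in> sphere 0 1"
  shows "spherical_design 2 (orbit G (diagonal_action \<phi>) x) \<longleftrightarrow> quadratic_defect form x = 0"
proof -
  let ?X = "orbit G (diagonal_action \<phi>) x"
  let ?N = "card ?X"
  let ?\<delta> = "\<lambda>i j. (if i = j then 1 / 2 else 0 :: real)"
  have X: "finite ?X" "?X \<noteq> {}" "?X \<subseteq> sphere 0 1"
    using x finite_orbit orbit_self norm_diagonal_action by (auto simp: orbit_def)
  then have N: "?N > 0" by (simp add: card_gt_0_iff)
  have moment: "(\<Sum>y\<in>?X. (y \<bullet> axis i u) * (y \<bullet> axis j v)) =
      (?N / DIM('w)) * ((u \<cdot> form (x $ i) (x $ j)) \<bullet> v)" for i j u v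
    using arg_cong [OF orbit_moment [of u i j x], of "\<lambda>z. z \<bullet> v"]
    by (simp add: inner_axis inner_sum_left inner_commute [of u])
  \<comment> \<open>The 1/2 on the diagonal arises because the dimension of \<open>'w^2\<close> is
    twice that of \<open>'w\<close>.\<close>
  have target: "?N * (axis i u \<bullet> axis j v) / DIM('w^2) =
      (?N / DIM('w)) * ((u \<cdot> (?\<delta> i j *\<^sub>R 1)) \<bullet> v)" for i j :: 2 and u v :: 'w
    by (auto simp: inner_axis_axis act_scaleR act_one)
  have eq: "(\<Sum>y\<in>?X. (y \<bullet> axis i u) * (y \<bullet> axis j v)) = ?N * (axis i u \<bullet> axis j v) / DIM('w^2)
      \<longleftrightarrow> (u \<cdot> (quadratic_defect form x $ i $ j)) \<bullet> v = 0" for i j u v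
  proof -
    interpret V: right_vector_space "(\<cdot>)" by (rule right_vector_space_act)
    show ?thesis
      unfolding moment target quadratic_defect_component V.act_diff inner_diff_left
      using N by simp
  qed
  have "spherical_design 2 ?X \<longleftrightarrow>
      (\<forall>i j. \<forall>u\<in>Basis. \<forall>v\<in>Basis. (u \<cdot> (quadratic_defect form x $ i $ j)) \<bullet> v = 0)"
    unfolding spherical_design_2_iff [OF X] eq [symmetric]
    by (auto simp: sum_orbit_eq_0 Basis_vec_def)
  also have "\<dots> \<longleftrightarrow> (\<forall>i j. \<forall>u\<in>Basis. u \<cdot> (quadratic_defect form x $ i $ j) = 0)"
    by (metis euclidean_all_zero_iff inner_zero_left)
  also have "\<dots> \<longleftrightarrow> (\<forall>i j. quadratic_defect form x $ i $ j = 0)"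
  proof -
    have "norm (u \<cdot> a) = norm a" if "u \<in> Basis" for u a
      using that by (simp add: norm_act)
    then have "(\<forall>u\<in>Basis. u \<cdot> a = 0) \<longleftrightarrow> a = 0" for a
      by (metis SOME_Basis norm_eq_zero)
    then show ?thesis by simp
  qed
  finally show ?thesis by (simp add: vec_eq_iff)
qed

end

section \<open>Hermitian matrices of size two\<close>

text \<open>Real linear coordinates on the traceless Hermitian matrices. In them the trace form is
  twice the Euclidean inner product, so the standard basis of \<open>real \<times> 'd\<close> gives
  an orthogonal basis whose vectors have squared length 2.\<close>

definition traceless_matrix :: "real \<times> 'd::rch \<Rightarrow> 'd^2^2"
  where "traceless_matrix p =
    vector [vector [fst p *\<^sub>R 1, snd p], vector [conjugate (snd p), - (fst p *\<^sub>R 1)]]"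

lemma linear_traceless_matrix: "linear traceless_matrix"
  by (rule linearI)
    (simp_all add: traceless_matrix_def vec_eq_iff forall_2 conjugate_add conjugate_scaleR
      scaleR_add_left)

lemma inj_traceless_matrix: "inj traceless_matrix"
  by (rule injI) (simp add: traceless_matrix_def vec_eq_iff forall_2 prod_eq_iff)

lemma conjugate_scaleR_one: "conjugate (t *\<^sub>R 1 :: 'd::rch) = t *\<^sub>R 1"
  by (simp add: conjugate_scaleR conjugate_one)

lemma conjugate_uminus: "conjugate (- a) = - conjugate a"
  using conjugate_scaleR [of "- 1" a] by simp

lemma range_traceless_matrix: "range (traceless_matrix :: real \<times> 'd::rch \<Rightarrow> 'd^2^2) = traceless_hermitian"
proof (intro equalityI subsetI)
  fix B :: "'d^2^2" assume "B \<in> range traceless_matrix"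
  then show "B \<in> traceless_hermitian"
    by (auto simp: traceless_matrix_def traceless_hermitian_def forall_2 trace_def sum_2
        conjugate_conjugate conjugate_scaleR_one conjugate_uminus)
next
  fix B :: "'d^2^2" assume B: "B \<in> traceless_hermitian"
  then have conj: "\<forall>i j. B $ j $ i = conjugate (B $ i $ j)" and tr: "B $ 1 $ 1 + B $ 2 $ 2 = 0"
    unfolding traceless_hermitian_def trace_def sum_2 by blast+
  have "conjugate (B $ 1 $ 1) = B $ 1 $ 1" using conj by metis
  then obtain t where t: "B $ 1 $ 1 = t *\<^sub>R 1" using conjugate_eq_self_iff by blast
  have "B $ 2 $ 2 = - (t *\<^sub>R 1)" using tr unfolding t by (simp add: add_eq_0_iff)
  moreover have "B $ 2 $ 1 = conjugate (B $ 1 $ 2)" using conj by blast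
  ultimately have "B = traceless_matrix (t, B $ 1 $ 2)"
    using t by (simp add: traceless_matrix_def vec_eq_iff forall_2)
  then show "B \<in> range traceless_matrix" by blast
qed

lemma dim_traceless_hermitian: "dim (traceless_hermitian :: ('d::rch^2^2) set) = DIM('d) + 1"
proof -
  have "dim (range (traceless_matrix :: real \<times> 'd \<Rightarrow> _)) = dim (UNIV :: (real \<times> 'd) set)"
    by (rule dim_image_eq [OF linear_traceless_matrix]) (simp add: inj_traceless_matrix)
  then show ?thesis by (simp add: range_traceless_matrix)
qed

text \<open>With p = (t, z) and p' = (t', z'), the diagonal entries of the product are t t' + z
  conj(z') and conj(z) z' + t t', and both have real part \<open>p \<bullet> p'\<close>.\<close>

lemma trace_inner_traceless_matrix:
  "trace_inner (traceless_matrix p) (traceless_matrix p') = 2 * (p \<bullet> p')"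
  by (simp add: trace_inner_def traceless_matrix_def trace_def matrix_matrix_mult_def sum_2
      re_part_add re_part_scaleR re_part_one re_part_conjugate_mult re_part_mult_conjugate
      inner_prod_def)

section \<open>Ranks computed from real dimensions\<close>

lemma matrix_rank_mult_DIM:
  fixes A :: "'d::rch^'n^'m"
  shows "matrix_rank A * DIM('d) = dim (range ((*v) A))"
proof -
  interpret right_vector_space "\<lambda>(v::'d^'m) a. \<chi> i. v $ i * a"
    by unfold_locales (simp_all add: vec_eq_iff algebra_simps)
  have "linear ((*v) A)"
    by (rule linearI) (simp_all add: matrix_vector_mult_def vec_eq_iff distrib_left sum.distrib
        scaleR_sum_right)
  \<comment> \<open>Matrix entries multiply from the left and scalars act from the right, so
    associativity makes the range a right subspace.\<close>
  moreover have "(\<chi> i. (A *v v) $ i * a) = A *v (\<chi> i. v $ i * a)" for v a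
    by (simp add: matrix_vector_mult_def sum_distrib_right mult.assoc)
  ultimately show ?thesis
    unfolding matrix_rank_def
    by (intro right_dim_mult_DIM) (auto intro: linear_subspace_image)
qed

text \<open>The difference of the two sides acts as a determinant: the diagonal entries are central,
  and \<open>z\<close> commutes with its conjugate. If it vanishes, the range is a copy of
  \<open>'d\<close>; otherwise the adjugate matrix shows that the range is everything. The
  assumption excludes the zero matrix.\<close>

lemma matrix_rank_hermitian_2:
  fixes z :: "'d::rch"
  assumes "a \<noteq> 0 \<or> b \<noteq> 0"
  defines "A \<equiv> vector [vector [a *\<^sub>R 1, z], vector [conjugate z, b *\<^sub>R 1]] :: 'd^2^2"
  shows "matrix_rank A = 1 \<longleftrightarrow> a * b = (norm z)\<^sup>2"
proof -
  have A: "A *v v = vector [a *\<^sub>R v $ 1 + z * v $ 2, conjugate z * v $ 1 + b *\<^sub>R v $ 2]" for v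
    by (simp add: A_def matrix_vector_mult_def vec_eq_iff forall_2 sum_2)
  have one: "matrix_rank A = 1" if "range ((*v) A) = range f" "linear f" "inj f" for f :: "'d \<Rightarrow> 'd^2"
  proof -
    have "dim (range f) = dim (UNIV :: 'd set)"
      by (rule dim_image_eq) (use that in auto)
    then show ?thesis using matrix_rank_mult_DIM [of A] that(1) by simp
  qed
  show ?thesis
  proof (cases "a * b = (norm z)\<^sup>2")
    case True
    have "matrix_rank A = 1"
    proof (cases "a = 0")
      case False
      \<comment> \<open>A vanishing determinant makes the second row the left multiple of the first
        by \<open>(1 / a) *\<^sub>R conjugate z\<close>, so the range is the graph of this left
        multiplication.\<close>
      let ?f = "\<lambda>t. vector [t, (1 / a) *\<^sub>R (conjugate z * t)] :: 'd^2"
      have "A *v v = ?f (a *\<^sub>R v $ 1 + z * v $ 2)" for v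
      proof -
        have "conjugate z * (z * v $ 2) = (a * b) *\<^sub>R v $ 2"
          by (simp add: True conjugate_mult_self flip: mult.assoc)
        then show ?thesis using False by (simp add: A vec_eq_iff forall_2 distrib_left scaleR_add_right)
      qed
      moreover have "?f t = A *v vector [(1 / a) *\<^sub>R t, 0]" for t
        using False by (simp add: A vec_eq_iff forall_2)
      ultimately have "range ((*v) A) = range ?f" by (metis (no_types, lifting) rangeI image_subsetI subset_antisym)
      then show ?thesis
        by (rule one)
          (auto intro!: linearI injI simp: vec_eq_iff forall_2 distrib_left scaleR_add_right)
    next
      case a: True
      then have z: "z = 0" and b: "b \<noteq> 0" using True assms(1) by auto
      let ?f = "\<lambda>t. vector [0, t] :: 'd^2"
      have "A *v v = ?f (b *\<^sub>R v $ 2)" for v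
        by (simp add: A a z vec_eq_iff forall_2 conjugate_def re_part_def)
      moreover have "?f t = A *v vector [0, (1 / b) *\<^sub>R t]" for t
        using b by (simp add: A z vec_eq_iff forall_2)
      ultimately have "range ((*v) A) = range ?f" by (metis (no_types, lifting) rangeI image_subsetI subset_antisym)
      then show ?thesis
        by (rule one) (auto intro!: linearI injI simp: vec_eq_iff forall_2)
    qed
    then show ?thesis using True by simp
  next
    case False
    define D where "D = a * b - (norm z)\<^sup>2"
    have D: "D \<noteq> 0" using False by (simp add: D_def)
    \<comment> \<open>The preimage of \<open>u\<close> is the adjugate, with rows (b, -z) and
      (-conj(z), a), applied to \<open>u\<close> and divided by the determinant
      \<open>D\<close>.\<close>
    have "u = A *v ((1 / D) *\<^sub>R vector [b *\<^sub>R u $ 1 - z * u $ 2, a *\<^sub>R u $ 2 - conjugate z * u $ 1])" for u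
    proof -
      have "z * (conjugate z * u $ 1) = (norm z)\<^sup>2 *\<^sub>R u $ 1" "conjugate z * (z * u $ 2) = (norm z)\<^sup>2 *\<^sub>R u $ 2"
        by (simp_all add: conjugate_mult_self mult_self_conjugate flip: mult.assoc)
      then have "a *\<^sub>R (b *\<^sub>R u $ 1 - z * u $ 2) + z * (a *\<^sub>R u $ 2 - conjugate z * u $ 1) = D *\<^sub>R u $ 1"
        "conjugate z * (b *\<^sub>R u $ 1 - z * u $ 2) + b *\<^sub>R (a *\<^sub>R u $ 2 - conjugate z * u $ 1) = D *\<^sub>R u $ 2"
        by (simp_all add: D_def algebra_simps)
      then have "A *v vector [b *\<^sub>R u $ 1 - z * u $ 2, a *\<^sub>R u $ 2 - conjugate z * u $ 1] = D *\<^sub>R u"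
        by (simp add: A vec_eq_iff forall_2)
      moreover have "A *v (r *\<^sub>R v) = r *\<^sub>R (A *v v)" for r v
        by (simp add: A vec_eq_iff forall_2 scaleR_add_right)
      ultimately show ?thesis using D by simp
    qed
    then have "range ((*v) A) = UNIV" by blast
    then have "matrix_rank A * DIM('d) = 2 * DIM('d)" using matrix_rank_mult_DIM [of A] by simp
    then show ?thesis using False by simp
  qed
qed

section \<open>The weight of the design orbits\<close>

context hermitian_module
begin

text \<open>The squared norms of the two components add up to 1, so subtracting 1/2 from each makes
  the diagonal entries opposite.\<close>

lemma quadratic_defect_eq_traceless_matrix:
  assumes x: "norm x = 1"
  shows "quadratic_defect form x =
    traceless_matrix ((norm (x $ 1))\<^sup>2 - 1 / 2, form (x $ 1) (x $ 2))"
proof -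
  have "(norm (x $ 2))\<^sup>2 = 1 - (norm (x $ 1))\<^sup>2"
    using x by (simp add: norm_vec_def L2_set_def sum_2)
  then show ?thesis
    using form_hermitian [of "x $ 1" "x $ 2"]
    by (simp add: vec_eq_iff forall_2 quadratic_defect_component traceless_matrix_def form_self
        conjugate_conjugate
        algebra_simps flip: scaleR_add_left scaleR_diff_left)
qed

lemma
  assumes x: "norm x = 1"
  shows trace_inner_quadratic_defect_le:
      "trace_inner (quadratic_defect form x) (quadratic_defect form x) \<le> 1 / 2"
    and trace_inner_quadratic_defect_eq_iff:
      "trace_inner (quadratic_defect form x) (quadratic_defect form x) = 1 / 2 \<longleftrightarrow>
        matrix_rank (hermitian_gram form x) = 1"
proof -
  define a b z where "a = (norm (x $ 1))\<^sup>2" and "b = (norm (x $ 2))\<^sup>2" and "z = form (x $ 1) (x $ 2)"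
  have ab: "a + b = 1" using x by (simp add: a_def b_def norm_vec_def L2_set_def sum_2)
  \<comment> \<open>Since a + b = 1, the square of a - 1/2 is 1/4 - a b.\<close>
  have eq: "trace_inner (quadratic_defect form x) (quadratic_defect form x) =
      1 / 2 - 2 * (a * b - (norm z)\<^sup>2)"
  proof -
    have b: "b = 1 - a" using ab by simp
    show ?thesis
      unfolding quadratic_defect_eq_traceless_matrix [OF x] trace_inner_traceless_matrix
        inner_prod_def b fst_conv snd_conv inner_real_def a_def [symmetric] z_def [symmetric]
        dot_square_norm
      by (simp add: power2_eq_square field_simps)
  qed
  have "(norm z)\<^sup>2 \<le> (norm (x $ 1) * norm (x $ 2))\<^sup>2"
    unfolding z_def by (rule power_mono [OF norm_form_le]) simp
  then show "trace_inner (quadratic_defect form x) (quadratic_defect form x) \<le> 1 / 2"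
    by (simp add: eq a_def b_def power_mult_distrib)
  have "hermitian_gram form x = vector [vector [a *\<^sub>R 1, z], vector [conjugate z, b *\<^sub>R 1]]"
    using form_hermitian [of "x $ 1" "x $ 2"]
    by (simp add: hermitian_gram_def vec_eq_iff forall_2 form_self a_def b_def z_def
        conjugate_conjugate)
  moreover have "a \<noteq> 0 \<or> b \<noteq> 0" using ab by auto
  ultimately show "trace_inner (quadratic_defect form x) (quadratic_defect form x) = 1 / 2 \<longleftrightarrow>
      matrix_rank (hermitian_gram form x) = 1"
    using matrix_rank_hermitian_2 [of a b z] by (auto simp: eq)
qed

text \<open>Take \<open>B = C\<close> in the tight frame identity, running through the orthogonal
  basis given by \<open>traceless_matrix\<close>, and add up. Parseval's identity turns the inner
  sums into squared lengths.\<close>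

lemma sum_trace_inner_quadratic_defect:
  fixes x :: "'i \<Rightarrow> 'w^2"
  assumes x: "\<And>i. i \<in> I \<Longrightarrow> norm (x i) = 1"
    and tight: "\<And>B C. B \<in> traceless_hermitian \<Longrightarrow> C \<in> traceless_hermitian \<Longrightarrow>
      (\<Sum>i\<in>I. w i * trace_inner B (quadratic_defect form (x i)) *
        trace_inner C (quadratic_defect form (x i))) = c * trace_inner B C"
  shows "(\<Sum>i\<in>I. w i * trace_inner (quadratic_defect form (x i)) (quadratic_defect form (x i))) =
    c * dim (traceless_hermitian :: ('d^2^2) set)"
proof -
  define p where "p i = ((norm (x i $ 1))\<^sup>2 - 1 / 2, form (x i $ 1) (x i $ 2))" for i
  have Z: "quadratic_defect form (x i) = traceless_matrix (p i)" if "i \<in> I" for i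
    using quadratic_defect_eq_traceless_matrix [OF x [OF that]] by (simp add: p_def)
  have "(\<Sum>i\<in>I. w i * (2 * (e \<bullet> p i)) * (2 * (e \<bullet> p i))) = c * 2" if "e \<in> Basis" for e
    using tight [of "traceless_matrix e" "traceless_matrix e"] that
    by (simp add: Z trace_inner_traceless_matrix flip: range_traceless_matrix)
  then have "(\<Sum>e\<in>Basis. \<Sum>i\<in>I. w i * (2 * (e \<bullet> p i)) * (2 * (e \<bullet> p i))) =
      2 * (c * DIM(real \<times> 'd))" by simp
  moreover have "(\<Sum>e\<in>Basis. \<Sum>i\<in>I. w i * (2 * (e \<bullet> p i)) * (2 * (e \<bullet> p i))) =
      (\<Sum>i\<in>I. \<Sum>e\<in>Basis. w i * (2 * (e \<bullet> p i)) * (2 * (e \<bullet> p i)))"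
    by (rule sum.swap)
  moreover have "(\<Sum>i\<in>I. \<Sum>e\<in>Basis. w i * (2 * (e \<bullet> p i)) * (2 * (e \<bullet> p i))) =
      2 * (\<Sum>i\<in>I. w i * trace_inner (quadratic_defect form (x i)) (quadratic_defect form (x i)))"
  proof -
    \<comment> \<open>One of the two factors 2 belongs to \<open>trace_inner\<close>; the other
      cancels against the squared length 2 of the basis matrices.\<close>
    have "(\<Sum>e\<in>Basis. w i * (2 * (e \<bullet> p i)) * (2 * (e \<bullet> p i))) = 2 * (w i * (2 * (p i \<bullet> p i)))" for i
      by (subst (3) euclidean_inner) (simp add: sum_distrib_left inner_commute mult_ac)
    then show ?thesis by (simp add: Z trace_inner_traceless_matrix sum_distrib_left)
  qed
  ultimately show ?thesis by (simp add: dim_traceless_hermitian)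
qed

end

theorem theorem5p3:
  fixes G :: "('g, 'm) monoid_scheme"
    and \<phi> :: "'g \<Rightarrow> 'w::euclidean_space \<Rightarrow> 'w"
    and act :: "'w \<Rightarrow> 'd::rch \<Rightarrow> 'w"
    and form :: "'w \<Rightarrow> 'w \<Rightarrow> 'd"
    and x :: "nat \<Rightarrow> 'w^2" and w :: "nat \<Rightarrow> real" and s :: nat
  defines "d \<equiv> real DIM('d)"
    and "n \<equiv> real (right_dim act (UNIV :: 'w set))"
    and "q \<equiv> real DIM('w)"
    and "E \<equiv> (traceless_hermitian :: ('d^2^2) set)"
  defines "r \<equiv> real (dim E)"
    and "H \<equiv> hermitian_gram form"
    and "Z \<equiv> \<lambda>i. quadratic_defect form (x i)"
    and "design_orbit \<equiv> \<lambda>i. spherical_design 2 (orbit G (diagonal_action \<phi>) (x i))"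
  defines "\<alpha> \<equiv> (\<Sum>i | i \<in> {1..s} \<and> Z i \<noteq> 0. w i)"
    and "\<beta> \<equiv> (\<Sum>i | i \<in> {1..s} \<and> design_orbit i. w i)"
  assumes "hermitian_module G \<phi> act form"
    and "\<And>i. i \<in> {1..s} \<Longrightarrow> x i \<in> sphere 0 1"
    and "\<And>i. i \<in> {1..s} \<Longrightarrow> w i > 0"
    and "(\<Sum>i=1..s. w i) = 1"
    and "(\<Sum>i=1..s. w i *\<^sub>R Z i) = 0"
    and "\<And>B C. B \<in> E \<Longrightarrow> C \<in> E \<Longrightarrow>
           (\<Sum>i=1..s. w i * trace_inner B (Z i) * trace_inner C (Z i))
             = 1 / (2 * (q + 1)) * trace_inner B C"
    and "\<exists>i\<in>{1..s}. design_orbit i"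
  shows "\<alpha> \<ge> r / (q + 1) \<and> r / (q + 1) = (d + 1) / (d * n + 1)
    \<and> \<beta> \<le> d * (n - 1) / (d * n + 1)
    \<and> (\<alpha> = r / (q + 1) \<longleftrightarrow> (\<forall>i\<in>{1..s}. Z i \<noteq> 0 \<longrightarrow> matrix_rank (H (x i)) = 1))
    \<and> (\<beta> = d * (n - 1) / (d * n + 1) \<longleftrightarrow> (\<forall>i\<in>{1..s}. Z i \<noteq> 0 \<longrightarrow> matrix_rank (H (x i)) = 1))"
proof -
  interpret hermitian_module G \<phi> act form by fact
  define t where "t i = trace_inner (Z i) (Z i)" for i
  let ?J = "{i \<in> {1..s}. Z i \<noteq> 0}"
  have x: "norm (x i) = 1" if "i \<in> {1..s}" for i using assms(12) [OF that] by simp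
  have q: "q = d * n" by (simp add: q_def d_def n_def DIM_eq_right_dim)
  have r: "r = d + 1" by (simp add: r_def d_def E_def dim_traceless_hermitian)
  have q0: "q + 1 > 0" by (simp add: q_def add_nonneg_pos)
  \<comment> \<open>Isolated arithmetic for \<open>gap\<close>: \<open>a\<close> stands for
    \<open>\<alpha>\<close>, \<open>e\<close> for \<open>r / (q + 1)\<close>, \<open>b\<close> for
    the weighted sum of the \<open>t i\<close>, and \<open>c\<close> for that of the deficits
    \<open>1 / 2 - t i\<close>.\<close>
  have halves: "a - e = 2 * c" if "b = e / 2" "c = a / 2 - b" for a b c e :: real
    using that by simp
  have "(\<Sum>i=1..s. w i * t i) = 1 / (2 * (q + 1)) * r"
    unfolding t_def r_def E_def Z_def
    by (rule sum_trace_inner_quadratic_defect) (use x assms(16) in \<open>simp_all add: E_def Z_def\<close>)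
  moreover have "(\<Sum>i=1..s. w i * t i) = (\<Sum>i\<in>?J. w i * t i)"
  proof (rule sum.mono_neutral_right)
    show "\<forall>i\<in>{1..s} - ?J. w i * t i = 0"
      by (auto simp: t_def trace_inner_def re_part_def trace_def matrix_matrix_mult_def)
  qed auto
  ultimately have "(\<Sum>i\<in>?J. w i * t i) = r / (q + 1) / 2"
    by (simp add: mult.commute)
  moreover have "(\<Sum>i\<in>?J. w i * (1 / 2 - t i)) = \<alpha> / 2 - (\<Sum>i\<in>?J. w i * t i)"
    by (simp add: \<alpha>_def right_diff_distrib sum_subtractf sum_divide_distrib)
  \<comment> \<open>The excess of \<open>\<alpha>\<close> over the bound is a sum of nonnegative
    terms. This yields the inequality, and equality means that every term vanishes.\<close>
  ultimately have gap: "\<alpha> - r / (q + 1) = 2 * (\<Sum>i\<in>?J. w i * (1 / 2 - t i))"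
    by (rule halves)
  have nonneg: "0 \<le> w i * (1 / 2 - t i)" if "i \<in> ?J" for i
    using that assms(13) trace_inner_quadratic_defect_le [OF x] by (simp add: t_def Z_def less_imp_le)
  have "0 \<le> \<alpha> - r / (q + 1)"
    unfolding gap by (rule mult_nonneg_nonneg [OF zero_le_numeral sum_nonneg [OF nonneg]])
  then have ge: "\<alpha> \<ge> r / (q + 1)" by (rule diff_ge_0_iff_ge [THEN iffD1])
  have "\<alpha> = r / (q + 1) \<longleftrightarrow> (\<Sum>i\<in>?J. w i * (1 / 2 - t i)) = 0" using gap by linarith
  also have "\<dots> \<longleftrightarrow> (\<forall>i\<in>?J. w i * (1 / 2 - t i) = 0)"
    using nonneg by (intro sum_nonneg_eq_0_iff) auto
  also have "\<dots> \<longleftrightarrow> (\<forall>i\<in>?J. matrix_rank (H (x i)) = 1)"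
  proof (intro ball_cong refl)
    fix i assume "i \<in> ?J"
    then have i: "i \<in> {1..s}" by simp
    \<comment> \<open>As \<open>w i\<close> is positive, the term vanishes only if
      \<open>t i\<close> attains its maximum 1/2.\<close>
    show "w i * (1 / 2 - t i) = 0 \<longleftrightarrow> matrix_rank (H (x i)) = 1"
      using assms(13) [OF i] trace_inner_quadratic_defect_eq_iff [OF x [OF i]]
      by (auto simp: t_def Z_def H_def)
  qed
  finally have eq: "\<alpha> = r / (q + 1) \<longleftrightarrow> (\<forall>i\<in>{1..s}. Z i \<noteq> 0 \<longrightarrow> matrix_rank (H (x i)) = 1)"
    by auto
  \<comment> \<open>Design orbits are exactly those with \<open>Z i = 0\<close>, so the two index
    sets partition \<open>{1..s}\<close>. Each bound and each equality case for
    \<open>\<beta>\<close> thus mirrors one for \<open>\<alpha>\<close>.\<close>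
  have "\<alpha> + \<beta> = 1"
  proof -
    have "{i. i \<in> {1..s} \<and> design_orbit i} = {1..s} - ?J"
      using spherical_design_orbit_iff [OF assms(12)] by (auto simp: design_orbit_def Z_def)
    moreover have "sum w {1..s} = sum w ({1..s} - ?J) + sum w ?J"
      by (rule sum.subset_diff) auto
    ultimately show ?thesis using assms(14) by (simp only: \<alpha>_def \<beta>_def add.commute)
  qed
  moreover have "d * (n - 1) / (d * n + 1) = 1 - r / (q + 1)"
    using q0 by (simp add: q r field_simps)
  ultimately have "\<beta> \<le> d * (n - 1) / (d * n + 1) \<longleftrightarrow> \<alpha> \<ge> r / (q + 1)"
    "\<beta> = d * (n - 1) / (d * n + 1) \<longleftrightarrow> \<alpha> = r / (q + 1)"
    by linarith+
  then show ?thesis using ge eq q r by simp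
qed

end
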